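(* Let $\pi=\pi_1+i\pi_2$ be a complex Poisson bivector on a smooth manifold $M$ ($\pi_1,\pi_2$ real bivectors), with graph $L_\pi=\{\pi^\sharp(\alpha)+\alpha : \alpha\in T^*_{\mathbb C}M\}$. Then $L_\pi$ is a generalized complex structure if and only if $\pi_2$ is invertible (i.e. $\pi_2^\sharp:T^*M\to TM$ is an isomorphism). In this case, the generalized complex map $\mathcal J_\pi:\mathbb TM\to\mathbb TM$ associated to $L_\pi$ is given, with respect to $\mathbb TM=TM\oplus T^*M$, by $$\mathcal J_\pi=\begin{pmatrix}-\pi_1\pi_2^{-1} & \pi_1\pi_2^{-1}\pi_1+\pi_2\\ -\pi_2^{-1} & \pi_2^{-1}\pi_1\end{pmatrix}.$$ In particular, the bivector $\sigma=\pi_1\pi_2^{-1}\pi_1+\pi_2$ is the Poisson bivector associated to $\mathcal J_\pi$.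
   Context: $T_{\mathbb C}M=TM\otimes\mathbb C$, $\mathbb TM=TM\oplus T^*M$, $\mathbb T_{\mathbb C}M=\mathbb TM\otimes\mathbb C$, with the canonical symmetric pairing and the Courant–Dorfman bracket $[X+\xi,Y+\eta]=[X,Y]+\mathcal L_X\eta-\iota_Yd\xi$, extended $\mathbb C$-bilinearly. A complex Poisson bivector is $\pi\in\Gamma(\wedge^2T_{\mathbb C}M)$ with $[\pi,\pi]=0$ (complexified Schouten bracket). Bivectors are identified with the bundle maps $\pi_j=\pi_j^\sharp:T^*M\to TM$, and $\pi^\sharp(\xi+i\eta)=\pi_1\xi-\pi_2\eta+i(\pi_2\xi+\pi_1\eta)$. A complex Dirac structure is a lagrangian subbundle of $\mathbb T_{\mathbb C}M$ involutive for the Courant–Dorfman bracket; it is a generalized complex structure if $L\cap\overline L=0$ (equivalently $L\cap\mathbb TM=0$). The generalized complex map associated to such $L$ is the orthogonal bundle map $\mathcal J:\mathbb TM\to\mathbb TM$, $\mathcal J^2=-\mathrm{Id}$, with $L=\{v+i\mathcal Jv : v\in\mathbb TM\}$ (i.e. $L$ is the $(-i)$-eigenbundle of $\mathcal J$). The Poisson bivector associated to $\mathcal J$ is the one whose $\sharp$-map is the upper-right block $T^*M\to TM$ of $\mathcal J$. *)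

theory Defs
  imports "HOL-Analysis.Analysis"
begin

section \<open>Smooth maps and smooth manifolds\<close>

text \<open>
  \<open>S\<close> is meant to be open: a \<open>C\<close>-(k+1) map is a differentiable one all of whose directional
  derivatives are \<open>C\<close>-k.
\<close>

primrec C_on :: "nat \<Rightarrow> 'a::real_normed_vector set \<Rightarrow> ('a \<Rightarrow> 'b::real_normed_vector) \<Rightarrow> bool" where
  "C_on 0 S f \<longleftrightarrow> continuous_on S f"
| "C_on (Suc k) S f \<longleftrightarrow>
     (\<forall>x\<in>S. f differentiable (at x)) \<and> (\<forall>v. C_on k S (\<lambda>x. frechet_derivative f (at x) v))"

definition smooth_on :: "'a::real_normed_vector set \<Rightarrow> ('a \<Rightarrow> 'b::real_normed_vector) \<Rightarrow> bool" where
  "smooth_on S f \<longleftrightarrow> (\<forall>k. C_on k S f)"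

type_synonym ('m, 'n) chart = "'m set \<times> ('m \<Rightarrow> real^'n)"

definition chart_inv :: "('m, 'n::finite) chart \<Rightarrow> real^'n \<Rightarrow> 'm" where
  "chart_inv c = inv_into (fst c) (snd c)"

text \<open>
  A smooth manifold is a Hausdorff second countable space \<open>'m\<close> together with an atlas. The atlas is
  not required to be maximal: smoothness with respect to an atlas and with respect to the maximal
  atlas containing it are the same.
\<close>

definition smooth_atlas :: "('m::{t2_space,second_countable_topology}, 'n::finite) chart set \<Rightarrow> bool" where
  "smooth_atlas A \<longleftrightarrow>
     (\<Union>c\<in>A. fst c) = UNIV \<and>
     (\<forall>c\<in>A. open (fst c) \<and> open (snd c ` fst c) \<and>
        homeomorphism (fst c) (snd c ` fst c) (snd c) (chart_inv c)) \<and>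
     (\<forall>c\<in>A. \<forall>d\<in>A. smooth_on (snd c ` (fst c \<inter> fst d)) (snd d \<circ> chart_inv c))"

section \<open>Tensor fields\<close>

text \<open>
  The fibre \<open>T\<^sub>pM\<close> is modelled as \<open>real^'n\<close>, a tangent vector being represented by its
  components in one fixed chart \<open>chart_at A p\<close> around \<open>p\<close>; dually for \<open>T\<^sup>*\<^sub>pM\<close>. The components in
  any other chart are obtained with the Jacobian matrices of the coordinate changes, and smoothness
  of a tensor field means smoothness of its components in every chart. The scalars \<open>'a\<close> are
  \<open>real\<close> for \<open>TM\<close> and \<open>complex\<close> for the complexification of \<open>TM\<close>.
\<close>

definition chart_at :: "('m, 'n::finite) chart set \<Rightarrow> 'm \<Rightarrow> ('m, 'n) chart" where
  "chart_at A p = (SOME c. c \<in> A \<and> p \<in> fst c)"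

definition jac :: "('m, 'n::finite) chart \<Rightarrow> ('m, 'n) chart \<Rightarrow> 'm \<Rightarrow> 'a::real_normed_field^'n^'n" where
  "jac c d p = map_matrix of_real (matrix (frechet_derivative (snd d \<circ> chart_inv c) (at (snd c p))))"

definition contract :: "'a::comm_ring_1^'n \<Rightarrow> 'a^'n::finite \<Rightarrow> 'a" where
  "contract \<xi> X = (\<Sum>i\<in>UNIV. \<xi> $ i * X $ i)"

text \<open>Elements \<open>X + \<xi>\<close> of a fibre of \<open>TM \<oplus> T\<^sup>*M\<close> (or of its complexification) are pairs \<open>(X, \<xi>)\<close>.\<close>

type_synonym ('a, 'n) gtangent = "('a^'n) \<times> ('a^'n)"

definition pairing :: "('a::comm_ring_1, 'n::finite) gtangent \<Rightarrow> ('a, 'n) gtangent \<Rightarrow> 'a" where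
  "pairing v w = contract (snd w) (fst v) + contract (snd v) (fst w)"

definition gscale :: "'a::comm_ring_1 \<Rightarrow> ('a, 'n::finite) gtangent \<Rightarrow> ('a, 'n) gtangent" where
  "gscale a v = (a *s fst v, a *s snd v)"

global_interpretation gtangent: vector_space "gscale :: 'a::field \<Rightarrow> ('a, 'n::finite) gtangent \<Rightarrow> _"
  by unfold_locales
    (auto simp: gscale_def vec_eq_iff algebra_simps)

text \<open>From components in the chart \<open>c\<close> at \<open>p\<close> to components in the chart \<open>d\<close>.\<close>

definition change_chart ::
  "('m, 'n::finite) chart \<Rightarrow> ('m, 'n) chart \<Rightarrow> 'm \<Rightarrow> ('a::real_normed_field, 'n) gtangent \<Rightarrow> ('a, 'n) gtangent"
  where "change_chart c d p v = (jac c d p *v fst v, transpose (jac d c p) *v snd v)"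

definition section_rep ::
  "('m, 'n::finite) chart set \<Rightarrow> ('m, 'n) chart \<Rightarrow> ('m \<Rightarrow> ('a::real_normed_field, 'n) gtangent)
    \<Rightarrow> real^'n \<Rightarrow> ('a, 'n) gtangent" where
  "section_rep A c e x = (let p = chart_inv c x in change_chart (chart_at A p) c p (e p))"

definition smooth_section_on ::
  "('m, 'n::finite) chart set \<Rightarrow> 'm set \<Rightarrow> ('m \<Rightarrow> ('a::real_normed_field, 'n) gtangent) \<Rightarrow> bool" where
  "smooth_section_on A W e \<longleftrightarrow> (\<forall>c\<in>A. smooth_on (snd c ` (fst c \<inter> W)) (section_rep A c e))"

text \<open>
  A bivector at a point is given by its components \<open>\<pi>\<^sup>i\<^sup>j = \<pi>(dx\<^sup>i, dx\<^sup>j)\<close>, and its sharp map is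
  characterized by \<open>\<langle>\<eta>, \<pi>\<^sup>\<sharp>\<xi>\<rangle> = \<pi>(\<xi>, \<eta>)\<close>.
\<close>

definition bivector_rep ::
  "('m, 'n::finite) chart set \<Rightarrow> ('m, 'n) chart \<Rightarrow> ('m \<Rightarrow> 'a::real_normed_field^'n^'n)
    \<Rightarrow> real^'n \<Rightarrow> 'a^'n^'n" where
  "bivector_rep A c \<pi> x =
     (let p = chart_inv c x; J = jac (chart_at A p) c p in J ** \<pi> p ** transpose J)"

definition bivector_field ::
  "('m, 'n::finite) chart set \<Rightarrow> ('m \<Rightarrow> 'a::real_normed_field^'n^'n) \<Rightarrow> bool" where
  "bivector_field A \<pi> \<longleftrightarrow>
     (\<forall>p. transpose (\<pi> p) = - \<pi> p) \<and> (\<forall>c\<in>A. smooth_on (snd c ` fst c) (bivector_rep A c \<pi>))"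

definition sharp :: "'a::comm_ring_1^'n^'n \<Rightarrow> 'a^'n \<Rightarrow> 'a^'n::finite" where
  "sharp P \<xi> = \<xi> v* P"

section \<open>Brackets\<close>

definition pd :: "'n::finite \<Rightarrow> (real^'n \<Rightarrow> 'a::real_normed_field) \<Rightarrow> real^'n \<Rightarrow> 'a" where
  "pd l f x = frechet_derivative f (at x) (axis l 1)"

text \<open>
  The Schouten bracket is the biderivation extending the Lie bracket by
  \<open>[X\<^sub>1 \<and> X\<^sub>2, Y\<^sub>1 \<and> Y\<^sub>2] = \<Sum>\<^sub>i\<^sub>j (-1)\<^sup>i\<^sup>+\<^sup>j [X\<^sub>i, Y\<^sub>j] \<and> X\<^sub>3\<^sub>-\<^sub>i \<and> Y\<^sub>3\<^sub>-\<^sub>j\<close>. In components this is the cyclic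
  sum over \<open>i, j, k\<close> of \<open>P\<^sup>i\<^sup>l \<partial>\<^sub>l Q\<^sup>j\<^sup>k + Q\<^sup>i\<^sup>l \<partial>\<^sub>l P\<^sup>j\<^sup>k\<close>.
\<close>

definition schouten_local ::
  "(real^'n::finite \<Rightarrow> 'a::real_normed_field^'n^'n) \<Rightarrow> (real^'n \<Rightarrow> 'a^'n^'n) \<Rightarrow> real^'n \<Rightarrow> 'a^'n^'n^'n" where
  "schouten_local P Q x =
     (let t = (\<lambda>i j k. \<Sum>l\<in>UNIV. P x $ i $ l * pd l (\<lambda>y. Q y $ j $ k) x
                              + Q x $ i $ l * pd l (\<lambda>y. P y $ j $ k) x)
      in \<chi> i j k. t i j k + t j k i + t k i j)"

text \<open>
  The brackets of tensor fields are computed in local coordinates; the value at \<open>p\<close> is expressed, like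
  any tensor at \<open>p\<close>, by its components in \<open>chart_at A p\<close>.
\<close>

definition schouten ::
  "('m, 'n::finite) chart set \<Rightarrow> ('m \<Rightarrow> 'a::real_normed_field^'n^'n) \<Rightarrow> ('m \<Rightarrow> 'a^'n^'n)
    \<Rightarrow> 'm \<Rightarrow> 'a^'n^'n^'n" where
  "schouten A \<pi> \<rho> p =
     (let c = chart_at A p in schouten_local (bivector_rep A c \<pi>) (bivector_rep A c \<rho>) (snd c p))"

definition poisson ::
  "('m, 'n::finite) chart set \<Rightarrow> ('m \<Rightarrow> 'a::real_normed_field^'n^'n) \<Rightarrow> bool" where
  "poisson A \<pi> \<longleftrightarrow> bivector_field A \<pi> \<and> (\<forall>p. schouten A \<pi> \<pi> p = 0)"

definition lie_bracket ::
  "(real^'n::finite \<Rightarrow> 'a::real_normed_field^'n) \<Rightarrow> (real^'n \<Rightarrow> 'a^'n) \<Rightarrow> real^'n \<Rightarrow> 'a^'n" where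
  "lie_bracket X Y x =
     (\<chi> j. \<Sum>l\<in>UNIV. X x $ l * pd l (\<lambda>y. Y y $ j) x - Y x $ l * pd l (\<lambda>y. X y $ j) x)"

definition lie_derivative ::
  "(real^'n::finite \<Rightarrow> 'a::real_normed_field^'n) \<Rightarrow> (real^'n \<Rightarrow> 'a^'n) \<Rightarrow> real^'n \<Rightarrow> 'a^'n" where
  "lie_derivative X \<eta> x =
     (\<chi> j. \<Sum>l\<in>UNIV. X x $ l * pd l (\<lambda>y. \<eta> y $ j) x + \<eta> x $ l * pd j (\<lambda>y. X y $ l) x)"

text \<open>Components of a two-form are \<open>\<omega>\<^sub>i\<^sub>j = \<omega>(\<partial>\<^sub>i, \<partial>\<^sub>j)\<close>, so \<open>Y v* \<omega>\<close> is the contraction \<open>\<iota>\<^sub>Y\<omega>\<close>.\<close>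

definition ext_d :: "(real^'n::finite \<Rightarrow> 'a::real_normed_field^'n) \<Rightarrow> real^'n \<Rightarrow> 'a^'n^'n" where
  "ext_d \<xi> x = (\<chi> i j. pd i (\<lambda>y. \<xi> y $ j) x - pd j (\<lambda>y. \<xi> y $ i) x)"

definition courant_local ::
  "(real^'n::finite \<Rightarrow> ('a::real_normed_field, 'n) gtangent) \<Rightarrow> (real^'n \<Rightarrow> ('a, 'n) gtangent)
    \<Rightarrow> real^'n \<Rightarrow> ('a, 'n) gtangent" where
  "courant_local e f x =
     (lie_bracket (fst \<circ> e) (fst \<circ> f) x,
      lie_derivative (fst \<circ> e) (snd \<circ> f) x - fst (f x) v* ext_d (snd \<circ> e) x)"

definition courant ::
  "('m, 'n::finite) chart set \<Rightarrow> ('m \<Rightarrow> ('a::real_normed_field, 'n) gtangent)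
    \<Rightarrow> ('m \<Rightarrow> ('a, 'n) gtangent) \<Rightarrow> 'm \<Rightarrow> ('a, 'n) gtangent" where
  "courant A e f p =
     (let c = chart_at A p in courant_local (section_rep A c e) (section_rep A c f) (snd c p))"

section \<open>Complex Dirac and generalized complex structures\<close>

definition smooth_subbundle ::
  "('m::topological_space, 'n::finite) chart set \<Rightarrow> ('m \<Rightarrow> ('a::real_normed_field, 'n) gtangent set) \<Rightarrow> bool" where
  "smooth_subbundle A L \<longleftrightarrow>
     (\<exists>r::nat. \<forall>p. \<exists>W. open W \<and> p \<in> W \<and>
        (\<exists>e. (\<forall>i<r. smooth_section_on A W (e i)) \<and>
             (\<forall>q\<in>W. inj_on (\<lambda>i. e i q) {..<r} \<and>
                gtangent.independent ((\<lambda>i. e i q) ` {..<r}) \<and>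
                gtangent.span ((\<lambda>i. e i q) ` {..<r}) = L q)))"

definition lagrangian :: "('a::comm_ring_1, 'n::finite) gtangent set \<Rightarrow> bool" where
  "lagrangian V \<longleftrightarrow> V = {v. \<forall>w\<in>V. pairing v w = 0}"

definition involutive ::
  "('m, 'n::finite) chart set \<Rightarrow> ('m \<Rightarrow> ('a::real_normed_field, 'n) gtangent set) \<Rightarrow> bool" where
  "involutive A L \<longleftrightarrow>
     (\<forall>e f. smooth_section_on A UNIV e \<longrightarrow> smooth_section_on A UNIV f \<longrightarrow>
        (\<forall>p. e p \<in> L p) \<longrightarrow> (\<forall>p. f p \<in> L p) \<longrightarrow> (\<forall>p. courant A e f p \<in> L p))"

definition complex_dirac ::
  "('m::topological_space, 'n::finite) chart set \<Rightarrow> ('m \<Rightarrow> (complex, 'n) gtangent set) \<Rightarrow> bool" where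
  "complex_dirac A L \<longleftrightarrow> smooth_subbundle A L \<and> (\<forall>p. lagrangian (L p)) \<and> involutive A L"

definition gcnj :: "(complex, 'n::finite) gtangent \<Rightarrow> (complex, 'n) gtangent" where
  "gcnj v = (\<chi> i. cnj (fst v $ i), \<chi> i. cnj (snd v $ i))"

definition generalized_complex ::
  "('m::topological_space, 'n::finite) chart set \<Rightarrow> ('m \<Rightarrow> (complex, 'n) gtangent set) \<Rightarrow> bool" where
  "generalized_complex A L \<longleftrightarrow> complex_dirac A L \<and> (\<forall>p. L p \<inter> gcnj ` L p = {0})"

text \<open>The element \<open>v + iw\<close> of the complexified fibre, for real \<open>v\<close> and \<open>w\<close>.\<close>

definition gComplex :: "(real, 'n::finite) gtangent \<Rightarrow> (real, 'n) gtangent \<Rightarrow> (complex, 'n) gtangent" where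
  "gComplex v w = (\<chi> i. Complex (fst v $ i) (fst w $ i), \<chi> i. Complex (snd v $ i) (snd w $ i))"

definition smooth_bundle_endo ::
  "('m, 'n::finite) chart set \<Rightarrow> ('m \<Rightarrow> (real, 'n) gtangent \<Rightarrow> (real, 'n) gtangent) \<Rightarrow> bool" where
  "smooth_bundle_endo A J \<longleftrightarrow>
     (\<forall>p. linear (J p)) \<and>
     (\<forall>c\<in>A. \<forall>w. smooth_on (snd c ` fst c)
        (\<lambda>x. let p = chart_inv c x; d = chart_at A p in change_chart d c p (J p (change_chart c d p w))))"

text \<open>\<open>L\<close> is the \<open>(-i)\<close>-eigenbundle of its generalized complex map \<open>J\<close>.\<close>

definition generalized_complex_map ::
  "('m, 'n::finite) chart set \<Rightarrow> ('m \<Rightarrow> (complex, 'n) gtangent set)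
    \<Rightarrow> ('m \<Rightarrow> (real, 'n) gtangent \<Rightarrow> (real, 'n) gtangent) \<Rightarrow> bool" where
  "generalized_complex_map A L J \<longleftrightarrow>
     smooth_bundle_endo A J \<and>
     (\<forall>p v w. pairing (J p v) (J p w) = pairing v w) \<and>
     (\<forall>p v. J p (J p v) = - v) \<and>
     (\<forall>p. L p = {gComplex v (J p v) | v. True})"

definition associated_poisson ::
  "('m, 'n::finite) chart set \<Rightarrow> ('m \<Rightarrow> (real, 'n) gtangent \<Rightarrow> (real, 'n) gtangent)
    \<Rightarrow> ('m \<Rightarrow> real^'n^'n) \<Rightarrow> bool" where
  "associated_poisson A J \<sigma> \<longleftrightarrow> poisson A \<sigma> \<and> (\<forall>p \<xi>. sharp (\<sigma> p) \<xi> = fst (J p (0, \<xi>)))"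

definition complex_bivector ::
  "('m \<Rightarrow> real^'n^'n) \<Rightarrow> ('m \<Rightarrow> real^'n^'n) \<Rightarrow> 'm \<Rightarrow> complex^'n^'n::finite" where
  "complex_bivector \<pi>\<^sub>1 \<pi>\<^sub>2 p = (\<chi> i j. Complex (\<pi>\<^sub>1 p $ i $ j) (\<pi>\<^sub>2 p $ i $ j))"

definition bivector_graph :: "('m \<Rightarrow> 'a::comm_ring_1^'n^'n) \<Rightarrow> 'm \<Rightarrow> ('a, 'n::finite) gtangent set" where
  "bivector_graph \<pi> p = {(sharp (\<pi> p) \<alpha>, \<alpha>) | \<alpha>. True}"

end

theory Submission
  imports Defs
begin

text \<open>
  All brackets are evaluated at \<open>p\<close> in the chart \<open>chart_at A p\<close>, so it suffices to compute there: the
  Courant bracket of \<open>\<pi>\<^sup>\<sharp>\<alpha> + \<alpha>\<close> and \<open>\<pi>\<^sup>\<sharp>\<beta> + \<beta>\<close> differs from an element of the graph by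
  \<open>\<onehalf>[\<pi>, \<pi>](\<alpha>, \<beta>, \<cdot>)\<close>. Real points of the graph are pairs \<open>(\<pi>\<^sub>1\<xi>, \<xi>)\<close> with \<open>\<pi>\<^sub>2\<xi> = 0\<close>, and for
  invertible \<open>\<pi>\<^sub>2\<close> the condition \<open>v + iw \<in> L\<close> can be solved uniquely for \<open>w = J v\<close>; orthogonality of
  \<open>J\<close> is the real part of isotropy of \<open>L\<close>. That \<open>\<sigma>\<close> is Poisson follows from involutivity applied to the
  local sections \<open>dx\<^sup>a + i J dx\<^sup>a\<close> of \<open>L\<close>: the bracket of two of them has vector part
  \<open>-[\<sigma>dx\<^sup>a, \<sigma>dx\<^sup>b]\<close> and imaginary covector part \<open>d\<sigma>\<^sup>a\<^sup>b\<close>, so that \<open>[\<sigma>dx\<^sup>a, \<sigma>dx\<^sup>b] = \<sigma>(d\<sigma>\<^sup>a\<^sup>b)\<close>,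
  which is the Jacobi identity.
\<close>

section \<open>Calculus of smooth functions\<close>

lemma C_on_cong:
  fixes f :: "'a::real_normed_vector \<Rightarrow> 'b::real_normed_vector"
  assumes "open S" "\<And>x. x \<in> S \<Longrightarrow> f x = g x" "C_on k S f"
  shows "C_on k S g"
  using assms(2,3)
proof (induction k arbitrary: f g)
  case 0
  have "continuous_on S f"
    using "0.prems"(2) by simp
  from continuous_on_eq[OF this "0.prems"(1)] show ?case
    by simp
next
  case (Suc k)
  have d: "(g has_derivative frechet_derivative f (at x)) (at x)" if "x \<in> S" for x
  proof (rule has_derivative_transform_within_open[OF _ assms(1) that])
    show "(f has_derivative frechet_derivative f (at x)) (at x)"
      using Suc.prems(2) that by (simp add: frechet_derivative_works[symmetric])
  qed (rule Suc.prems(1))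
  have "C_on k S (\<lambda>x. frechet_derivative g (at x) v)" for v
  proof (rule Suc.IH)
    show "C_on k S (\<lambda>x. frechet_derivative f (at x) v)"
      using Suc.prems(2) by simp
  qed (simp add: frechet_derivative_at[OF d, symmetric])
  then show ?case
    using d by (auto simp: differentiable_def)
qed

text \<open>Lets the sum, product and quotient rules be fed in as explicit derivatives
  \<open>D x\<close>: by uniqueness of the derivative, \<open>D x\<close> is
  \<open>frechet_derivative f (at x)\<close> on \<open>S\<close>.\<close>

lemma C_on_SucI:
  fixes f :: "'a::real_normed_vector \<Rightarrow> 'b::real_normed_vector"
  assumes "open S" "\<And>x. x \<in> S \<Longrightarrow> (f has_derivative D x) (at x)"
    and "\<And>v. C_on k S (\<lambda>x. D x v)"
  shows "C_on (Suc k) S f"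
proof -
  have "C_on k S (\<lambda>x. frechet_derivative f (at x) v)" for v
    by (rule C_on_cong[OF assms(1) _ assms(3)[of v]])
       (simp add: frechet_derivative_at[OF assms(2), symmetric])
  then show ?thesis
    using assms(2) by (auto simp: differentiable_def)
qed

lemma C_on_has_derivative:
  "C_on (Suc k) S f \<Longrightarrow> x \<in> S \<Longrightarrow> (f has_derivative frechet_derivative f (at x)) (at x)"
  by (simp add: frechet_derivative_works[symmetric])

lemma C_on_Suc_D: "C_on (Suc k) S f \<Longrightarrow> C_on k S f"
proof (induction k arbitrary: f)
  case 0
  then show ?case
    by (auto intro!: continuous_at_imp_continuous_on differentiable_imp_continuous_within)
next
  case (Suc k)
  from Suc.prems have "C_on (Suc k) S (\<lambda>x. frechet_derivative f (at x) v)" for v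
    unfolding C_on.simps(2)[of "Suc k"] by blast
  then have "C_on k S (\<lambda>x. frechet_derivative f (at x) v)" for v
    by (rule Suc.IH)
  with Suc.prems show ?case
    by simp
qed

lemma C_on_subset: "C_on k S f \<Longrightarrow> T \<subseteq> S \<Longrightarrow> C_on k T f"
proof (induction k arbitrary: f)
  case 0
  then show ?case by (simp add: continuous_on_subset)
next
  case (Suc k)
  then have "C_on k T (\<lambda>x. frechet_derivative f (at x) v)" for v
    by simp
  then show ?case
    using Suc.prems by auto
qed

lemma C_on_const: "C_on k S (\<lambda>x. c)"
proof (induction k arbitrary: c)
  case (Suc k)
  then show ?case by (simp add: frechet_derivative_const)
qed simp

lemma C_on_add:
  fixes f g :: "'a::real_normed_vector \<Rightarrow> 'b::real_normed_vector"
  assumes "open S" "C_on k S f" "C_on k S g"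
  shows "C_on k S (\<lambda>x. f x + g x)"
  using assms(2,3)
proof (induction k arbitrary: f g)
  case 0
  then show ?case by (simp add: continuous_on_add)
next
  case (Suc k)
  note d = C_on_has_derivative[OF Suc.prems(1)] C_on_has_derivative[OF Suc.prems(2)]
  have D: "C_on k S (\<lambda>x. frechet_derivative f (at x) v)" "C_on k S (\<lambda>x. frechet_derivative g (at x) v)" for v
    using Suc.prems by simp_all
  show ?case
    by (rule C_on_SucI[OF assms(1) has_derivative_add[OF d]]) (assumption+, intro Suc.IH D)
qed

text \<open>By the Leibniz rule the derivative is a sum of two terms of the same shape
  \<open>B _ _\<close>, whose arguments are \<open>f\<close>, \<open>g\<close> and their
  derivatives, all of class \<open>k\<close>. The induction hypothesis therefore has to range over
  all \<open>f\<close> and \<open>g\<close>.\<close>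

lemma C_on_bilinear:
  fixes f :: "'a::real_normed_vector \<Rightarrow> 'b::real_normed_vector"
  assumes "open S" "bounded_bilinear B" "C_on k S f" "C_on k S g"
  shows "C_on k S (\<lambda>x. B (f x) (g x))"
  using assms(3,4)
proof (induction k arbitrary: f g)
  case 0
  then show ?case by (simp add: bounded_bilinear.continuous_on[OF assms(2)])
next
  case (Suc k)
  note d = C_on_has_derivative[OF Suc.prems(1)] C_on_has_derivative[OF Suc.prems(2)]
  note C = Suc.prems[THEN C_on_Suc_D]
  have D: "C_on k S (\<lambda>x. frechet_derivative f (at x) v)" "C_on k S (\<lambda>x. frechet_derivative g (at x) v)" for v
    using Suc.prems by simp_all
  show ?case
    by (rule C_on_SucI[OF assms(1) bounded_bilinear.FDERIV[OF assms(2) d]])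
       (assumption+, intro C_on_add[OF assms(1)] Suc.IH C D)
qed

text \<open>The derivative of 1/f is a product of 1/f, f' and 1/f; the induction hypothesis makes
  1/f of class \<open>k\<close>, so this product is again of class \<open>k\<close>.\<close>

lemma C_on_inverse:
  fixes f :: "'a::real_normed_vector \<Rightarrow> real"
  assumes "open S" "\<And>x. x \<in> S \<Longrightarrow> f x \<noteq> 0" "C_on k S f"
  shows "C_on k S (\<lambda>x. inverse (f x))"
  using assms(3)
proof (induction k)
  case 0
  then show ?case using assms(2) by (auto intro: continuous_on_inverse)
next
  case (Suc k)
  let ?D = "\<lambda>x v. - (inverse (f x) * frechet_derivative f (at x) v * inverse (f x))"
  have i: "C_on k S (\<lambda>x. inverse (f x))"
    by (rule Suc.IH[OF C_on_Suc_D[OF Suc.prems]])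
  have d: "C_on k S (\<lambda>x. frechet_derivative f (at x) v)" for v
    using Suc.prems by simp
  note mult = C_on_bilinear[OF assms(1) bounded_bilinear_mult]
  have "C_on k S (\<lambda>x. ?D x v)" for v
    using mult[OF C_on_const[of _ _ "- 1"] mult[OF mult[OF i d] i]] by simp
  moreover have "((\<lambda>x. inverse (f x)) has_derivative ?D x) (at x)" if "x \<in> S" for x
    using Deriv.has_derivative_inverse[OF assms(2)[OF that] C_on_has_derivative[OF Suc.prems that]] .
  ultimately show ?case
    by (rule C_on_SucI[OF assms(1), rotated])
qed

lemma smooth_on_cong:
  fixes f :: "'a::real_normed_vector \<Rightarrow> 'b::real_normed_vector"
  assumes "open S" "smooth_on S f" "\<And>x. x \<in> S \<Longrightarrow> f x = g x"
  shows "smooth_on S g"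
  using C_on_cong[OF assms(1) assms(3)] assms(2) by (auto simp: smooth_on_def)

lemma smooth_on_subset: "smooth_on S f \<Longrightarrow> T \<subseteq> S \<Longrightarrow> smooth_on T f"
  by (auto simp: smooth_on_def intro: C_on_subset)

lemma smooth_on_differentiable: "smooth_on S f \<Longrightarrow> x \<in> S \<Longrightarrow> f differentiable (at x)"
  unfolding smooth_on_def by (drule spec[of _ "Suc 0"]) simp

lemma smooth_on_frechet_derivative:
  "smooth_on S f \<Longrightarrow> smooth_on S (\<lambda>x. frechet_derivative f (at x) v)"
  unfolding smooth_on_def
proof
  show "C_on k S (\<lambda>x. frechet_derivative f (at x) v)" if "\<forall>k. C_on k S f" for k
    using that[rule_format, of "Suc k"] by simp
qed

lemma smooth_on_const: "smooth_on S (\<lambda>x. c)"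
  by (simp add: smooth_on_def C_on_const)

lemma smooth_on_add:
  fixes f g :: "'a::real_normed_vector \<Rightarrow> 'b::real_normed_vector"
  shows "open S \<Longrightarrow> smooth_on S f \<Longrightarrow> smooth_on S g \<Longrightarrow> smooth_on S (\<lambda>x. f x + g x)"
  by (simp add: smooth_on_def C_on_add)

lemma smooth_on_sum:
  fixes f :: "'i \<Rightarrow> 'a::real_normed_vector \<Rightarrow> 'b::real_normed_vector"
  assumes "open S" "\<And>i. i \<in> I \<Longrightarrow> smooth_on S (f i)"
  shows "smooth_on S (\<lambda>x. \<Sum>i\<in>I. f i x)"
  using assms(2)
proof (induction I rule: infinite_finite_induct)
  case (insert i I)
  then have "smooth_on S (f i)" "smooth_on S (\<lambda>x. \<Sum> i\<in>I. f i x)"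
    by simp_all
  from smooth_on_add[OF assms(1) this] show ?case
    using insert.hyps by simp
qed (simp_all add: smooth_on_const)

text \<open>On Euclidean spaces a bilinear map is automatically bounded, so applications only have
  to check algebraic bilinearity.\<close>

lemma smooth_on_bilinear:
  fixes f :: "'a::real_normed_vector \<Rightarrow> 'b::euclidean_space"
    and g :: "'a \<Rightarrow> 'c::euclidean_space"
    and B :: "'b \<Rightarrow> 'c \<Rightarrow> 'd::real_normed_vector"
  assumes "open S" "bilinear B" "smooth_on S f" "smooth_on S g"
  shows "smooth_on S (\<lambda>x. B (f x) (g x))"
  using assms C_on_bilinear unfolding smooth_on_def bilinear_conv_bounded_bilinear by blast

lemma smooth_on_linear:
  fixes f :: "'a::real_normed_vector \<Rightarrow> 'b::euclidean_space"
    and h :: "'b \<Rightarrow> 'd::real_normed_vector"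
  assumes "open S" "linear h" "smooth_on S f"
  shows "smooth_on S (\<lambda>x. h (f x))"
proof -
  \<comment> \<open>A linear map is the bilinear map of scalar multiplication and \<open>h\<close>,
    with the scalar frozen at the constant 1.\<close>
  have "bilinear (\<lambda>(a::real) b. a *\<^sub>R h b)"
    using assms(2) by (simp add: bilinear_def linear_iff scaleR_add_left scaleR_add_right scaleR_left_commute)
  from smooth_on_bilinear[OF assms(1) this smooth_on_const[of _ 1] assms(3)]
  show ?thesis by simp
qed

lemma smooth_on_mult:
  fixes f g :: "'a::real_normed_vector \<Rightarrow> real"
  shows "open S \<Longrightarrow> smooth_on S f \<Longrightarrow> smooth_on S g \<Longrightarrow> smooth_on S (\<lambda>x. f x * g x)"
  by (simp add: smooth_on_def C_on_bilinear[OF _ bounded_bilinear_mult])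

lemma smooth_on_prod:
  fixes f :: "'i \<Rightarrow> 'a::real_normed_vector \<Rightarrow> real"
  assumes "open S" "\<And>i. i \<in> I \<Longrightarrow> smooth_on S (f i)"
  shows "smooth_on S (\<lambda>x. \<Prod>i\<in>I. f i x)"
  using assms(2)
proof (induction I rule: infinite_finite_induct)
  case (insert i I)
  then have "smooth_on S (f i)" "smooth_on S (\<lambda>x. \<Prod> i\<in>I. f i x)"
    by simp_all
  from smooth_on_mult[OF assms(1) this] show ?case
    using insert.hyps by simp
qed (simp_all add: smooth_on_const)

lemma smooth_on_inverse:
  fixes f :: "'a::real_normed_vector \<Rightarrow> real"
  shows "open S \<Longrightarrow> (\<And>x. x \<in> S \<Longrightarrow> f x \<noteq> 0) \<Longrightarrow> smooth_on S f \<Longrightarrow> smooth_on S (\<lambda>x. inverse (f x))"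
  by (simp add: smooth_on_def C_on_inverse)

lemma smooth_on_vec_nth:
  fixes f :: "'a::real_normed_vector \<Rightarrow> 'b::euclidean_space^'n::finite"
  assumes "open S" "smooth_on S f"
  shows "smooth_on S (\<lambda>x. f x $ i)"
  by (rule smooth_on_linear[OF assms(1) _ assms(2)]) (simp add: linear_iff)

lemma smooth_on_vec:
  fixes f :: "'a::real_normed_vector \<Rightarrow> 'b::euclidean_space^'n::finite"
  assumes "open S" "\<And>i. smooth_on S (\<lambda>x. f x $ i)"
  shows "smooth_on S f"
proof -
  \<comment> \<open>The function is rebuilt as the sum of its components, each put back on its
    coordinate axis.\<close>
  have "linear (axis i :: 'b \<Rightarrow> 'b^'n)" for i
    by (auto simp: linear_iff vec_eq_iff axis_def)
  then have "smooth_on S (\<lambda>x. \<Sum>i\<in>UNIV. axis i (f x $ i))"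
    by (intro smooth_on_sum[OF assms(1)] smooth_on_linear[OF assms(1) _ assms(2)])
  then show ?thesis
    by (rule smooth_on_cong[OF assms(1)]) (simp add: vec_eq_iff axis_def)
qed

lemma smooth_on_Pair:
  fixes f :: "'a::real_normed_vector \<Rightarrow> 'b::euclidean_space" and g :: "'a \<Rightarrow> 'c::euclidean_space"
  assumes "open S" "smooth_on S f" "smooth_on S g"
  shows "smooth_on S (\<lambda>x. (f x, g x))"
proof -
  have "smooth_on S (\<lambda>x. (f x, 0) + (0, g x))"
    by (intro smooth_on_add[OF assms(1)] smooth_on_linear[OF assms(1) _ assms(2)]
        smooth_on_linear[OF assms(1) _ assms(3)])
      (auto simp: linear_iff)
  then show ?thesis by simp
qed

section \<open>Smooth matrix-valued functions: products, determinants, inverses\<close>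

lemma smooth_on_matrix_mult:
  fixes f :: "'a::real_normed_vector \<Rightarrow> 'b::{real_normed_field,euclidean_space}^'n::finite^'m::finite"
    and g :: "'a \<Rightarrow> 'b^'l::finite^'n"
  assumes "open S" "smooth_on S f" "smooth_on S g"
  shows "smooth_on S (\<lambda>x. f x ** g x)"
  by (rule smooth_on_bilinear[OF assms(1) _ assms(2,3)])
     (auto simp: bilinear_def linear_iff vec_eq_iff matrix_matrix_mult_def algebra_simps
        sum.distrib scaleR_sum_right)

lemma smooth_on_vector_matrix_mult:
  fixes f :: "'a::real_normed_vector \<Rightarrow> 'b::{real_normed_field,euclidean_space}^'n::finite"
    and g :: "'a \<Rightarrow> 'b^'l::finite^'n"
  assumes "open S" "smooth_on S f" "smooth_on S g"
  shows "smooth_on S (\<lambda>x. f x v* g x)"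
  by (rule smooth_on_bilinear[OF assms(1) _ assms(2,3)])
     (auto simp: bilinear_def linear_iff vec_eq_iff vector_matrix_mult_def algebra_simps
        sum.distrib scaleR_sum_right)

lemma smooth_on_det:
  fixes f :: "'a::real_normed_vector \<Rightarrow> real^'n^'n::finite"
  assumes "open S" "\<And>i j. smooth_on S (\<lambda>x. f x $ i $ j)"
  shows "smooth_on S (\<lambda>x. det (f x))"
  unfolding det_def
  by (intro smooth_on_sum smooth_on_mult smooth_on_prod smooth_on_const assms)

lemma matrix_inv_mult:
  fixes P :: "'a::semiring_1^'n^'n::finite"
  assumes "invertible P"
  shows "P ** matrix_inv P = mat 1" "matrix_inv P ** P = mat 1"
  using someI_ex[OF assms[unfolded invertible_def]] by (auto simp: matrix_inv_def)

text \<open>\<open>matrix_inv\<close> is a choice among two-sided inverses; for square matrices over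
  a field a right inverse is two-sided, so the choice is forced.\<close>

lemma matrix_inv_unique:
  fixes P :: "'a::field^'n^'n::finite"
  assumes "P ** Q = mat 1"
  shows "matrix_inv P = Q"
proof -
  have "invertible P"
    using assms invertible_right_inverse by blast
  then have "matrix_inv P ** (P ** Q) = Q"
    by (simp add: matrix_mul_assoc matrix_inv_mult)
  then show ?thesis
    by (simp add: assms)
qed

text \<open>Cramer's rule: the entry (k, l) of the inverse is the determinant of \<open>f x\<close>
  with column \<open>k\<close> replaced by the \<open>l\<close>-th unit vector, divided by
  \<open>det (f x)\<close>. Both determinants are polynomials in the entries.\<close>

lemma smooth_on_matrix_inv:
  fixes f :: "'a::real_normed_vector \<Rightarrow> real^'n^'n::finite"
  assumes S: "open S" and f: "smooth_on S f" and inv: "\<And>x. x \<in> S \<Longrightarrow> invertible (f x)"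
  shows "smooth_on S (\<lambda>x. matrix_inv (f x))"
proof -
  have nth: "smooth_on S (\<lambda>x. f x $ i $ j)" for i j
    by (intro smooth_on_vec_nth S f)
  have d: "det (f x) \<noteq> 0" if "x \<in> S" for x
    using inv[OF that] by (simp add: invertible_det_nz)
  have *: "smooth_on S (\<lambda>x. det (\<chi> i j. if j = k then axis l 1 $ i else f x $ i $ j) * inverse (det (f x)))" for k l
  proof (intro smooth_on_mult[OF S] smooth_on_inverse[OF S] smooth_on_det[OF S] d nth)
    show "smooth_on S (\<lambda>x. (\<chi> i j. if j = k then axis l 1 $ i else f x $ i $ j) $ i $ j)" for i j
      by (cases "j = k") (simp_all add: smooth_on_const nth)
  qed
  have "det (\<chi> i j. if j = k then axis l 1 $ i else f x $ i $ j) * inverse (det (f x)) = matrix_inv (f x) $ k $ l"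
    if x: "x \<in> S" for x k l
  proof -
    have "f x *v (matrix_inv (f x) *v axis l 1) = axis l 1"
      using inv[OF x] by (simp add: matrix_vector_mul_assoc matrix_inv_mult)
    then have "matrix_inv (f x) *v axis l 1 = (\<chi> k. det (\<chi> i j. if j = k then axis l 1 $ i else f x $ i $ j) / det (f x))"
      using cramer[OF d[OF x]] by blast
    then have "(matrix_inv (f x) *v axis l 1) $ k = det (\<chi> i j. if j = k then axis l 1 $ i else f x $ i $ j) / det (f x)"
      by simp
    then show ?thesis
      by (simp add: matrix_vector_mul_component divide_inverse matrix_vector_mult_basis column_def)
  qed
  then show ?thesis
    by (intro smooth_on_vec[OF S]) (rule smooth_on_cong[OF S *])
qed

section \<open>Graphs of Poisson bivectors in local coordinates\<close>

lemma pd_eq: "(f has_derivative f') (at x) \<Longrightarrow> pd l f x = f' (axis l 1)"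
  by (simp add: pd_def frechet_derivative_at[symmetric])

lemma pd_cong:
  assumes "open U" "x \<in> U" "\<And>y. y \<in> U \<Longrightarrow> f y = g y"
  shows "pd l f x = pd l g x"
proof -
  have "(f has_derivative D) (at x) \<longleftrightarrow> (g has_derivative D) (at x)" for D
    using has_derivative_transform_within_open[OF _ assms(1,2), of f D UNIV g]
      has_derivative_transform_within_open[OF _ assms(1,2), of g D UNIV f] assms(3)
    by auto
  then show ?thesis
    by (simp add: pd_def frechet_derivative_def)
qed

lemma pd_const [simp]: "pd l (\<lambda>y. c) x = 0"
  by (simp add: pd_def)

lemma pd_uminus:
  assumes "f differentiable (at x)"
  shows "pd l (\<lambda>y. - f y) x = - pd l f x"
  using pd_eq[OF has_derivative_minus[OF assms[unfolded frechet_derivative_works]]]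
  by (simp add: pd_def)

lemma pd_sum_mult:
  assumes "\<And>i. (\<lambda>y. f y $ i) differentiable (at x)" "\<And>i. g i differentiable (at x)"
  shows "pd l (\<lambda>y. \<Sum>i\<in>UNIV. f y $ i * g i y) x =
    (\<Sum>i\<in>UNIV. f x $ i * pd l (g i) x + pd l (\<lambda>y. f y $ i) x * g i x)"
  by (subst pd_eq[OF has_derivative_sum[OF has_derivative_mult[OF
        assms[unfolded frechet_derivative_works]]]])
     (simp add: pd_def)

lemma has_derivative_Complex:
  assumes "(f has_derivative f') F" "(g has_derivative g') F"
  shows "((\<lambda>y. Complex (f y) (g y)) has_derivative (\<lambda>v. Complex (f' v) (g' v))) F"
  unfolding Complex_eq
  by (intro has_derivative_add has_derivative_mult_right has_derivative_of_real assms)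

lemma differentiable_Complex:
  "f differentiable F \<Longrightarrow> g differentiable F \<Longrightarrow> (\<lambda>y. Complex (f y) (g y)) differentiable F"
  unfolding differentiable_def using has_derivative_Complex by blast

lemma pd_Complex:
  assumes "f differentiable (at x)" "g differentiable (at x)"
  shows "pd l (\<lambda>y. Complex (f y) (g y)) x = Complex (pd l f x) (pd l g x)"
  using pd_eq[OF has_derivative_Complex[OF assms[unfolded frechet_derivative_works]]]
  by (simp add: pd_def)

lemma skew_nth:
  fixes Q :: "'a::ab_group_add^'n^'n::finite"
  assumes "transpose Q = - Q"
  shows "Q $ i $ j = - Q $ j $ i"
  using arg_cong[OF assms, of "\<lambda>Q. Q $ j $ i"] by (simp add: transpose_def)

lemma transpose_complex_bivector:
  assumes "transpose (\<pi>\<^sub>1 p) = - \<pi>\<^sub>1 p" "transpose (\<pi>\<^sub>2 p) = - \<pi>\<^sub>2 p"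
  shows "transpose (complex_bivector \<pi>\<^sub>1 \<pi>\<^sub>2 p) = - complex_bivector \<pi>\<^sub>1 \<pi>\<^sub>2 p"
  unfolding vec_eq_iff
proof (intro allI)
  fix i j
  show "transpose (complex_bivector \<pi>\<^sub>1 \<pi>\<^sub>2 p) $ i $ j = (- complex_bivector \<pi>\<^sub>1 \<pi>\<^sub>2 p) $ i $ j"
    using skew_nth[OF assms(1), of j i] skew_nth[OF assms(2), of j i]
    by (simp add: transpose_def complex_bivector_def complex_eq_iff)
qed

section \<open>The Courant bracket of two sections of the graph of a Poisson bivector\<close>

lemma sum_swap_product:
  fixes a b :: "'i::finite \<Rightarrow> 'a::comm_ring_1"
  shows "(\<Sum>l\<in>UNIV. (\<Sum>m\<in>UNIV. a m * P m l) * (\<Sum>i\<in>UNIV. b i * D l i)) =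
    (\<Sum>m\<in>UNIV. \<Sum>i\<in>UNIV. a m * b i * (\<Sum>l\<in>UNIV. P m l * D l i))"
proof -
  have "(\<Sum>l\<in>UNIV. (\<Sum>m\<in>UNIV. a m * P m l) * (\<Sum>i\<in>UNIV. b i * D l i)) =
      (\<Sum>l\<in>UNIV. \<Sum>m\<in>UNIV. \<Sum>i\<in>UNIV. a m * b i * (P m l * D l i))"
    by (simp add: sum_product mult_ac)
  also have "\<dots> = (\<Sum>m\<in>UNIV. \<Sum>l\<in>UNIV. \<Sum>i\<in>UNIV. a m * b i * (P m l * D l i))"
    by (rule sum.swap)
  also have "\<dots> = (\<Sum>m\<in>UNIV. \<Sum>i\<in>UNIV. \<Sum>l\<in>UNIV. a m * b i * (P m l * D l i))"
    by (intro sum.cong refl sum.swap)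
  finally show ?thesis
    by (simp add: sum_distrib_left)
qed

text \<open>The algebra behind involutivity, with partial derivatives replaced by formal letters
  whose first index is the direction. \<open>a\<close> and \<open>b\<close> are the components of
  two one-forms \<alpha> and \<beta>, and \<open>dX\<close>, \<open>dY\<close> are given by the
  Leibniz rule. The two sides are the \<open>j\<close>-th components of [X, Y] and of the sharp of
  L_X \<beta> - i_Y d\<alpha>.\<close>

lemma poisson_graph_identity:
  fixes a b :: "'i::finite \<Rightarrow> 'a::comm_ring_1"
  assumes P: "\<And>i j. P i j = - P j i" and dP: "\<And>l i j. dP l i j = - dP l j i"
    and jacobi: "\<And>i j k. (\<Sum>l\<in>UNIV. P i l * dP l j k) + (\<Sum>l\<in>UNIV. P j l * dP l k i)
      + (\<Sum>l\<in>UNIV. P k l * dP l i j) = 0"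
    and X: "\<And>j. X j = (\<Sum>i\<in>UNIV. a i * P i j)" and Y: "\<And>j. Y j = (\<Sum>i\<in>UNIV. b i * P i j)"
    and dX: "\<And>l j. dX l j = (\<Sum>i\<in>UNIV. a i * dP l i j + da l i * P i j)"
    and dY: "\<And>l j. dY l j = (\<Sum>i\<in>UNIV. b i * dP l i j + db l i * P i j)"
  shows "(\<Sum>l\<in>UNIV. X l * dY l j - Y l * dX l j) =
    (\<Sum>k\<in>UNIV. P k j * ((\<Sum>l\<in>UNIV. X l * db l k + b l * dX k l)
       - (\<Sum>l\<in>UNIV. (da l k - da k l) * Y l)))"
proof -
  \<comment> \<open>Derivatives of \<open>a\<close> and \<open>b\<close> along the fields
    \<open>X\<close> and \<open>Y\<close> occur on both sides and match after exchanging the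
    sums.\<close>
  have swap: "(\<Sum>l\<in>UNIV. Z l * (\<Sum>i\<in>UNIV. dz l i * P i j)) = (\<Sum>k\<in>UNIV. P k j * (\<Sum>l\<in>UNIV. Z l * dz l k))"
    for Z dz
    by (subst sum_distrib_left, subst sum.swap) (simp add: sum_distrib_left mult_ac)
  \<comment> \<open>By skewness of \<open>P\<close>, the contribution of \<open>da\<close> to the
    Lie derivative cancels one of the two halves of i_Y d\<alpha>.\<close>
  have cancel: "(\<Sum>l\<in>UNIV. b l * (\<Sum>i\<in>UNIV. da k i * P i l)) = - (\<Sum>l\<in>UNIV. da k l * Y l)" for k
  proof -
    have "(\<Sum>l\<in>UNIV. da k l * Y l) = (\<Sum>l\<in>UNIV. \<Sum>i\<in>UNIV. da k i * (b l * P l i))"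
      by (subst sum.swap) (simp add: Y sum_distrib_left)
    also have "\<dots> = (\<Sum>l\<in>UNIV. - (b l * (\<Sum>i\<in>UNIV. da k i * P i l)))"
      unfolding sum_distrib_left sum_negf[symmetric]
      by (intro sum.cong refl) (subst P, simp add: mult_ac)
    finally show ?thesis
      by (simp add: sum_negf)
  qed
  have XY: "(\<Sum>l\<in>UNIV. X l * (\<Sum>i\<in>UNIV. b i * dP l i j)) =
      (\<Sum>m\<in>UNIV. \<Sum>i\<in>UNIV. a m * b i * (\<Sum>l\<in>UNIV. P m l * dP l i j))"
    unfolding X by (rule sum_swap_product)
  have YX: "(\<Sum>l\<in>UNIV. Y l * (\<Sum>i\<in>UNIV. a i * dP l i j)) =
      (\<Sum>m\<in>UNIV. \<Sum>i\<in>UNIV. a m * b i * (\<Sum>l\<in>UNIV. P i l * dP l m j))"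
    unfolding Y by (subst sum_swap_product, subst sum.swap) (simp add: mult_ac)
  have ab: "(\<Sum>k\<in>UNIV. P k j * (\<Sum>l\<in>UNIV. b l * (\<Sum>i\<in>UNIV. a i * dP k i l))) =
      (\<Sum>m\<in>UNIV. \<Sum>i\<in>UNIV. a m * b i * (\<Sum>l\<in>UNIV. P l j * dP l m i))"
  proof -
    have "(\<Sum>k\<in>UNIV. P k j * (\<Sum>l\<in>UNIV. b l * (\<Sum>i\<in>UNIV. a i * dP k i l))) =
        (\<Sum>k\<in>UNIV. \<Sum>l\<in>UNIV. \<Sum>i\<in>UNIV. a i * b l * (P k j * dP k i l))"
      by (simp add: sum_distrib_left mult_ac)
    also have "\<dots> = (\<Sum>k\<in>UNIV. \<Sum>i\<in>UNIV. \<Sum>l\<in>UNIV. a i * b l * (P k j * dP k i l))"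
      by (intro sum.cong refl sum.swap)
    also have "\<dots> = (\<Sum>i\<in>UNIV. \<Sum>k\<in>UNIV. \<Sum>l\<in>UNIV. a i * b l * (P k j * dP k i l))"
      by (rule sum.swap)
    also have "\<dots> = (\<Sum>i\<in>UNIV. \<Sum>l\<in>UNIV. \<Sum>k\<in>UNIV. a i * b l * (P k j * dP k i l))"
      by (intro sum.cong refl sum.swap)
    finally show ?thesis
      by (simp add: sum_distrib_left)
  qed
  \<comment> \<open>The three sums containing \<open>dP\<close> now all have the coefficients
    \<open>a m * b i\<close>. What remains to compare is the Jacobi identity, up to signs from the
    skewness of \<open>P\<close> and of \<open>dP\<close>.\<close>
  have jac: "(\<Sum>l\<in>UNIV. P m l * dP l i j) - (\<Sum>l\<in>UNIV. P i l * dP l m j) = (\<Sum>l\<in>UNIV. P l j * dP l m i)" for m i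
  proof -
    have "(\<Sum>l\<in>UNIV. P i l * dP l j m) = - (\<Sum>l\<in>UNIV. P i l * dP l m j)"
      unfolding sum_negf[symmetric] by (intro sum.cong refl) (subst dP, simp)
    moreover have "(\<Sum>l\<in>UNIV. P j l * dP l m i) = - (\<Sum>l\<in>UNIV. P l j * dP l m i)"
      unfolding sum_negf[symmetric] by (intro sum.cong refl) (subst P, simp)
    ultimately show ?thesis
      using jacobi[of m i j] by (simp add: algebra_simps)
  qed
  have main: "(\<Sum>l\<in>UNIV. X l * (\<Sum>i\<in>UNIV. b i * dP l i j)) - (\<Sum>l\<in>UNIV. Y l * (\<Sum>i\<in>UNIV. a i * dP l i j))
      = (\<Sum>k\<in>UNIV. P k j * (\<Sum>l\<in>UNIV. b l * (\<Sum>i\<in>UNIV. a i * dP k i l)))"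
    unfolding XY YX ab jac[symmetric] by (simp add: sum_subtractf right_diff_distrib)
  have "(\<Sum>l\<in>UNIV. X l * dY l j - Y l * dX l j) =
      ((\<Sum>l\<in>UNIV. X l * (\<Sum>i\<in>UNIV. b i * dP l i j)) - (\<Sum>l\<in>UNIV. Y l * (\<Sum>i\<in>UNIV. a i * dP l i j)))
      + (\<Sum>l\<in>UNIV. X l * (\<Sum>i\<in>UNIV. db l i * P i j)) - (\<Sum>l\<in>UNIV. Y l * (\<Sum>i\<in>UNIV. da l i * P i j))"
    unfolding dX dY by (simp add: sum.distrib sum_subtractf distrib_left)
  also have "\<dots> = (\<Sum>k\<in>UNIV. P k j * (\<Sum>l\<in>UNIV. b l * (\<Sum>i\<in>UNIV. a i * dP k i l)))
      + (\<Sum>k\<in>UNIV. P k j * (\<Sum>l\<in>UNIV. X l * db l k)) - (\<Sum>k\<in>UNIV. P k j * (\<Sum>l\<in>UNIV. Y l * da l k))"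
    unfolding main swap ..
  also have "\<dots> = (\<Sum>k\<in>UNIV. P k j * ((\<Sum>l\<in>UNIV. X l * db l k + b l * dX k l)
       - (\<Sum>l\<in>UNIV. (da l k - da k l) * Y l)))"
  proof -
    have inner: "(\<Sum>l\<in>UNIV. X l * db l k + b l * dX k l) - (\<Sum>l\<in>UNIV. (da l k - da k l) * Y l) =
        (\<Sum>l\<in>UNIV. b l * (\<Sum>i\<in>UNIV. a i * dP k i l)) + (\<Sum>l\<in>UNIV. X l * db l k)
        - (\<Sum>l\<in>UNIV. Y l * da l k)" for k
      using cancel[of k]
      by (simp add: dX sum.distrib sum_subtractf distrib_left left_diff_distrib mult.commute[of "Y _"])
    show ?thesis
      unfolding inner by (simp add: sum.distrib sum_subtractf distrib_left right_diff_distrib)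
  qed
  finally show ?thesis .
qed

text \<open>For equal arguments the two halves of each cyclic term coincide, so the bracket is twice
  the Jacobi sum, and 2 is invertible in the scalars.\<close>

lemma schouten_local_self_eq_0_iff:
  fixes P :: "real^'n::finite \<Rightarrow> 'a::real_normed_field^'n^'n"
  shows "schouten_local P P x = 0 \<longleftrightarrow> (\<forall>i j k. (\<Sum>l\<in>UNIV. P x $ i $ l * pd l (\<lambda>y. P y $ j $ k) x)
    + (\<Sum>l\<in>UNIV. P x $ j $ l * pd l (\<lambda>y. P y $ k $ i) x)
    + (\<Sum>l\<in>UNIV. P x $ k $ l * pd l (\<lambda>y. P y $ i $ j) x) = 0)"
proof -
  have double: "2 * a + 2 * b + 2 * c = 0 \<longleftrightarrow> a + b + c = 0" for a b c :: 'a
  proof -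
    have "2 * a + 2 * b + 2 * c = 2 * (a + b + c)"
      by (simp add: algebra_simps)
    then show ?thesis
      by (simp only: mult_eq_0_iff) simp
  qed
  show ?thesis
    by (simp add: schouten_local_def Let_def vec_eq_iff double flip: sum_distrib_left)
qed

text \<open>Stated for fields that lie in the graph near one point, so that it applies both to
  representatives of global sections and to frames that exist only in a chart. Skewness and the
  graph condition are assumed on a neighbourhood because they get differentiated.\<close>

lemma courant_local_in_graph:
  fixes P :: "real^'n::finite \<Rightarrow> 'a::real_normed_field^'n^'n"
  assumes U: "open U" "x \<in> U"
    and P: "\<And>i j. (\<lambda>y. P y $ i $ j) differentiable (at x)"
    and skew: "\<And>y. y \<in> U \<Longrightarrow> transpose (P y) = - P y"
    and poisson: "schouten_local P P x = 0"
    and e: "\<And>y. y \<in> U \<Longrightarrow> fst (e y) = sharp (P y) (snd (e y))"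
    and f: "\<And>y. y \<in> U \<Longrightarrow> fst (f y) = sharp (P y) (snd (f y))"
    and de: "\<And>i. (\<lambda>y. snd (e y) $ i) differentiable (at x)"
    and df: "\<And>i. (\<lambda>y. snd (f y) $ i) differentiable (at x)"
  shows "fst (courant_local e f x) = sharp (P x) (snd (courant_local e f x))"
proof -
  note skew' = skew_nth[OF skew]
  have dskew: "pd l (\<lambda>y. P y $ i $ j) x = - pd l (\<lambda>y. P y $ j $ i) x" for l i j
    by (rule trans[OF pd_cong[OF U skew'] pd_uminus[OF P]])
  have sharp: "sharp Q a $ j = (\<Sum>i\<in>UNIV. a $ i * Q $ i $ j)" for Q :: "'a^'n^'n" and a j
    by (simp add: sharp_def vector_matrix_mult_def mult.commute)
  have pd_sharp: "pd l (\<lambda>y. fst (g y) $ j) x =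
      (\<Sum>i\<in>UNIV. snd (g x) $ i * pd l (\<lambda>y. P y $ i $ j) x + pd l (\<lambda>y. snd (g y) $ i) x * P x $ i $ j)"
    if "\<And>y. y \<in> U \<Longrightarrow> fst (g y) = sharp (P y) (snd (g y))" "\<And>i. (\<lambda>y. snd (g y) $ i) differentiable (at x)"
    for g :: "real^'n \<Rightarrow> ('a, 'n) gtangent" and l j
    using pd_cong[OF U, of "\<lambda>y. fst (g y) $ j" "\<lambda>y. \<Sum>i\<in>UNIV. snd (g y) $ i * P y $ i $ j" l] that(1)
    by (simp add: sharp pd_sum_mult[OF that(2) P])
  note jacobi = poisson[unfolded schouten_local_self_eq_0_iff, rule_format]
  note identity = poisson_graph_identity[of "\<lambda>i j. P x $ i $ j" "\<lambda>l i j. pd l (\<lambda>y. P y $ i $ j) x",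
      OF skew'[OF U(2)] dskew jacobi,
      of "\<lambda>j. fst (e x) $ j" "\<lambda>i. snd (e x) $ i" "\<lambda>j. fst (f x) $ j" "\<lambda>i. snd (f x) $ i"
         "\<lambda>l j. pd l (\<lambda>y. fst (e y) $ j) x" "\<lambda>l i. pd l (\<lambda>y. snd (e y) $ i) x"
         "\<lambda>l j. pd l (\<lambda>y. fst (f y) $ j) x" "\<lambda>l i. pd l (\<lambda>y. snd (f y) $ i) x",
      OF _ _ pd_sharp[OF e de] pd_sharp[OF f df]]
  show ?thesis
    unfolding vec_eq_iff
    by (intro allI, rule trans[OF trans[OF _ identity]])
       (simp_all add: courant_local_def lie_bracket_def lie_derivative_def ext_d_def sharp e[OF U(2)] f[OF U(2)]
         vector_matrix_mult_def sharp_def mult.commute)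
qed

section \<open>The Jacobi identity for \<sigma> in coordinates\<close>

lemma sharp_complex_bivector:
  "sharp (complex_bivector \<pi>\<^sub>1 \<pi>\<^sub>2 p) (\<chi> i. Complex (a $ i) (b $ i)) =
    (\<chi> j. Complex ((sharp (\<pi>\<^sub>1 p) a - sharp (\<pi>\<^sub>2 p) b) $ j) ((sharp (\<pi>\<^sub>2 p) a + sharp (\<pi>\<^sub>1 p) b) $ j))"
  by (simp add: vec_eq_iff sharp_def complex_bivector_def vector_matrix_mult_def complex_eq_iff
      sum_subtractf sum.distrib)

text \<open>Brackets of the coordinate forms suffice: the relation [\<sigma>dx_a, \<sigma>dx_b] =
  \<sigma>(d\<sigma>_ab) comes from the graph condition, so the inverse matrix inside
  \<open>S\<close> is never differentiated explicitly.\<close>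

lemma schouten_local_sigma:
  fixes P\<^sub>1 P\<^sub>2 :: "real^'n::finite \<Rightarrow> real^'n^'n"
  assumes U: "open U" "x \<in> U"
    and smooth: "smooth_on U P\<^sub>1" "smooth_on U P\<^sub>2"
    and skew: "\<And>y. y \<in> U \<Longrightarrow> transpose (P\<^sub>1 y) = - P\<^sub>1 y" "\<And>y. y \<in> U \<Longrightarrow> transpose (P\<^sub>2 y) = - P\<^sub>2 y"
    and inv: "\<And>y. y \<in> U \<Longrightarrow> invertible (P\<^sub>2 y)"
    and poisson: "schouten_local (complex_bivector P\<^sub>1 P\<^sub>2) (complex_bivector P\<^sub>1 P\<^sub>2) x = 0"
    and S: "\<And>y. y \<in> U \<Longrightarrow> S y = P\<^sub>1 y ** matrix_inv (P\<^sub>2 y) ** P\<^sub>1 y + P\<^sub>2 y"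
    and S_skew: "\<And>y. y \<in> U \<Longrightarrow> transpose (S y) = - S y"
  shows "schouten_local S S x = 0"
proof -
  \<comment> \<open>Since \<open>sharp\<close> lets a row vector act from the left, matrix products
    compose in reverse order: the row \<open>R y $ a\<close> is the covector obtained from dx_a by
    applying \<open>\<pi>\<^sub>1\<close> and then the inverse of
    \<open>\<pi>\<^sub>2\<close>.\<close>
  define R where "R y = P\<^sub>1 y ** matrix_inv (P\<^sub>2 y)" for y
  have "smooth_on U R"
    unfolding R_def by (intro smooth_on_matrix_mult smooth_on_matrix_inv U smooth inv)
  moreover have "smooth_on U S"
    by (rule smooth_on_cong[OF U(1) _ S[symmetric]])
       (intro smooth_on_add smooth_on_matrix_mult smooth_on_matrix_inv U smooth inv)
  ultimately have diff: "(\<lambda>y. R y $ i $ j) differentiable (at x)" "(\<lambda>y. S y $ i $ j) differentiable (at x)"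
    "(\<lambda>y. P\<^sub>1 y $ i $ j) differentiable (at x)" "(\<lambda>y. P\<^sub>2 y $ i $ j) differentiable (at x)" for i j
    by (auto intro!: smooth_on_differentiable[OF _ U(2)] smooth_on_vec_nth[OF U(1)] smooth)
  note S_skew' = skew_nth[OF S_skew]
  have S_dskew: "pd l (\<lambda>y. S y $ i $ j) x = - pd l (\<lambda>y. S y $ j $ i) x" for l i j
    by (rule trans[OF pd_cong[OF U S_skew'] pd_uminus[OF diff(2)]])
  \<comment> \<open>\<open>e a\<close> is \<open>dx\<^sup>a + i J dx\<^sup>a\<close>, where \<open>J dx\<^sup>a = \<sigma>dx\<^sup>a + \<pi>\<^sub>2\<^sup>-\<^sup>1\<pi>\<^sub>1dx\<^sup>a\<close>\<close>
  define e where "e a y = ((\<chi> j. Complex 0 (S y $ a $ j)), (\<chi> j. Complex (axis a 1 $ j) (R y $ a $ j)))"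
    for a y
  have e: "fst (e a y) = sharp (complex_bivector P\<^sub>1 P\<^sub>2 y) (snd (e a y))" if y: "y \<in> U" for a y
  proof -
    have row: "Q $ a = axis a 1 v* Q" for Q :: "real^'n^'n"
      by (simp add: vec_eq_iff vector_matrix_mult_def axis_def if_distrib if_distribR cong: if_cong)
    have "R y ** P\<^sub>2 y = P\<^sub>1 y"
      using inv[OF y] by (simp add: R_def matrix_mul_assoc[symmetric] matrix_inv_mult)
    moreover have "S y = R y ** P\<^sub>1 y + P\<^sub>2 y"
      using S[OF y] by (simp add: R_def)
    \<comment> \<open>These are the real and imaginary parts of the graph condition for
      \<open>e a\<close>, whose vector part is purely imaginary.\<close>
    ultimately have "sharp (P\<^sub>1 y) (axis a 1) - sharp (P\<^sub>2 y) (R y $ a) = 0"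
      "sharp (P\<^sub>2 y) (axis a 1) + sharp (P\<^sub>1 y) (R y $ a) = S y $ a"
      unfolding row[of "R y"] row[of "S y"]
      by (simp_all add: sharp_def vector_matrix_mul_assoc vector_matrix_mult_add_rdistrib)
    then show ?thesis
      by (simp add: e_def sharp_complex_bivector)
  qed
  have bracket: "(\<Sum>l\<in>UNIV. S x $ a $ l * pd l (\<lambda>y. S y $ b $ j) x - S x $ b $ l * pd l (\<lambda>y. S y $ a $ j) x)
      = (\<Sum>l\<in>UNIV. S x $ l $ j * pd l (\<lambda>y. S y $ a $ b) x)" for a b j
  proof -
    define \<theta> where "\<theta> = (\<chi> l. pd l (\<lambda>y. S y $ a $ b) x)"
    define B where "B = (\<chi> j. \<Sum>l\<in>UNIV. S x $ a $ l * pd l (\<lambda>y. S y $ b $ j) x - S x $ b $ l * pd l (\<lambda>y. S y $ a $ j) x)"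
    let ?c = "courant_local (e a) (e b) x"
    \<comment> \<open>The real covector part of the bracket is never computed: the imaginary graph
      equation determines it because \<open>P\<^sub>2 x\<close> is invertible, and it is then
      eliminated from the real equation.\<close>
    define \<rho> where "\<rho> = (\<chi> j. Re (snd ?c $ j))"
    note pdC = pd_Complex[OF differentiable_const diff(1)] pd_Complex[OF differentiable_const diff(2)]
    have neg: "(- y) v* Q = - (y v* Q)" for y :: "real^'n" and Q :: "real^'n^'n"
      by (simp add: vec_eq_iff vector_matrix_mult_def sum_negf)
    have axis_sum: "(\<Sum>l\<in>UNIV. axis b 1 $ l * h l) = h b" for h :: "'n \<Rightarrow> real"
      by (simp add: axis_def if_distrib if_distribR cong: if_cong)
    \<comment> \<open>Both vector parts are \<open>i\<close> times a real field, and the square of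
      \<open>i\<close> gives the sign.\<close>
    have "fst ?c = (\<chi> j. Complex ((- B) $ j) 0)"
      by (simp add: courant_local_def lie_bracket_def e_def pdC vec_eq_iff complex_eq_iff B_def
          sum_subtractf sum_negf)
    \<comment> \<open>Terms with \<open>R\<close> or its derivatives pair two imaginary factors and
      are real. The imaginary part comes only from the constant form dx_b, contracted with the
      derivatives of row \<open>a\<close> of \<open>S\<close>.\<close>
    moreover have "snd ?c = (\<chi> j. Complex (\<rho> $ j) (\<theta> $ j))"
      by (simp add: courant_local_def lie_derivative_def ext_d_def vector_matrix_mult_def e_def pdC vec_eq_iff
          complex_eq_iff \<rho>_def \<theta>_def axis_sum)
    moreover have "fst ?c = sharp (complex_bivector P\<^sub>1 P\<^sub>2 x) (snd ?c)"
      by (rule courant_local_in_graph[OF U _ transpose_complex_bivector poisson e e])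
         (simp_all add: e_def complex_bivector_def differentiable_Complex diff skew)
    ultimately have "(\<chi> j. Complex ((- B) $ j) 0) = (\<chi> j. Complex ((sharp (P\<^sub>1 x) \<rho> - sharp (P\<^sub>2 x) \<theta>) $ j)
        ((sharp (P\<^sub>2 x) \<rho> + sharp (P\<^sub>1 x) \<theta>) $ j))"
      by (simp add: sharp_complex_bivector)
    then have re: "- B = \<rho> v* P\<^sub>1 x - \<theta> v* P\<^sub>2 x" and im: "\<rho> v* P\<^sub>2 x = - (\<theta> v* P\<^sub>1 x)"
      by (simp_all add: vec_eq_iff sharp_def eq_neg_iff_add_eq_0)
    have "\<rho> = \<rho> v* P\<^sub>2 x v* matrix_inv (P\<^sub>2 x)"
      using inv[OF U(2)] by (simp add: vector_matrix_mul_assoc matrix_inv_mult)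
    also have "\<dots> = - (\<theta> v* P\<^sub>1 x v* matrix_inv (P\<^sub>2 x))"
      by (simp add: im neg)
    also have "\<dots> = - (\<theta> v* R x)"
      by (simp add: vector_matrix_mul_assoc R_def)
    finally have "\<rho> v* P\<^sub>1 x = - (\<theta> v* (R x ** P\<^sub>1 x))"
      by (simp add: neg vector_matrix_mul_assoc)
    with re have "B = \<theta> v* (R x ** P\<^sub>1 x) + \<theta> v* P\<^sub>2 x"
      by (simp add: algebra_simps flip: minus_equation_iff)
    then have "B = \<theta> v* S x"
      using S[OF U(2)] by (simp add: R_def vector_matrix_mult_add_rdistrib)
    then show ?thesis
      by (simp add: B_def \<theta>_def vec_eq_iff vector_matrix_mult_def mult.commute)
  qed
  show ?thesis
    unfolding schouten_local_self_eq_0_iff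
  proof (intro allI)
    fix i j k
    \<comment> \<open>Skewness of \<open>S\<close> and of its derivatives turns component
      \<open>k\<close> of the bracket relation for \<open>i\<close> and \<open>j\<close> into the
      cyclic sum.\<close>
    have "(\<Sum>l\<in>UNIV. S x $ k $ l * pd l (\<lambda>y. S y $ i $ j) x) = - (\<Sum>l\<in>UNIV. S x $ l $ k * pd l (\<lambda>y. S y $ i $ j) x)"
      unfolding sum_negf[symmetric] by (intro sum.cong refl) (subst S_skew'[OF U(2)], simp)
    moreover have "(\<Sum>l\<in>UNIV. S x $ j $ l * pd l (\<lambda>y. S y $ k $ i) x) = - (\<Sum>l\<in>UNIV. S x $ j $ l * pd l (\<lambda>y. S y $ i $ k) x)"
      unfolding sum_negf[symmetric] by (intro sum.cong refl) (subst S_dskew, simp)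
    ultimately show "(\<Sum>l\<in>UNIV. S x $ i $ l * pd l (\<lambda>y. S y $ j $ k) x)
        + (\<Sum>l\<in>UNIV. S x $ j $ l * pd l (\<lambda>y. S y $ k $ i) x)
        + (\<Sum>l\<in>UNIV. S x $ k $ l * pd l (\<lambda>y. S y $ i $ j) x) = 0"
      using bracket[of i j k] by (simp add: sum_subtractf)
  qed
qed

section \<open>Charts and bundles of graphs\<close>

lemma map_matrix_of_real_mult:
  "(map_matrix of_real (P ** Q) :: 'a::real_normed_field^'l^'m) = map_matrix of_real P ** map_matrix of_real Q"
  for P :: "real^'n::finite^'m::finite" and Q :: "real^'l::finite^'n"
  by (simp add: vec_eq_iff map_matrix_def matrix_matrix_mult_def)

text \<open>Sharp maps commute with coordinate changes: a covector carries the inverse Jacobian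
  \<open>K\<close>, which cancels the left factor \<open>J\<close> of the transformed bivector, and
  the remaining transposed \<open>J\<close> acts on the resulting vector.\<close>

lemma sharp_congruence:
  fixes P :: "'a::comm_ring_1^'n^'n::finite"
  assumes "K ** J = mat 1"
  shows "sharp (J ** P ** transpose J) (transpose K *v \<xi>) = J *v sharp P \<xi>"
proof -
  have "\<xi> v* K v* (J ** P ** transpose J) = \<xi> v* ((K ** J) ** P ** transpose J)"
    by (simp add: vector_matrix_mul_assoc matrix_mul_assoc)
  also have "\<dots> = (\<xi> v* P) v* transpose J"
    by (simp add: assms vector_matrix_mul_assoc del: vector_transpose_matrix)
  finally show ?thesis
    by (simp add: sharp_def)
qed

context
  fixes A :: "('m::{t2_space,second_countable_topology}, 'n::finite) chart set"
  assumes atlas: "smooth_atlas A"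
begin

lemma
  assumes "c \<in> A"
  shows open_chart: "open (fst c)"
    and homeomorphism_chart: "homeomorphism (fst c) (snd c ` fst c) (snd c) (chart_inv c)"
  using atlas assms by (auto simp: smooth_atlas_def)

lemma
  shows chart_at_in_atlas: "chart_at A p \<in> A" and in_chart_at: "p \<in> fst (chart_at A p)"
proof -
  have "p \<in> (\<Union>c\<in>A. fst c)"
    using atlas by (simp only: smooth_atlas_def) simp
  then have "\<exists>c. c \<in> A \<and> p \<in> fst c"
    by blast
  then show "chart_at A p \<in> A" "p \<in> fst (chart_at A p)"
    unfolding chart_at_def by (metis (mono_tags, lifting) someI_ex)+
qed

lemma chart_inv_chart: "c \<in> A \<Longrightarrow> p \<in> fst c \<Longrightarrow> chart_inv c (snd c p) = p"
  using homeomorphism_chart by (rule homeomorphism_apply1)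

lemma open_chart_image:
  assumes "c \<in> A" "open W"
  shows "open (snd c ` (fst c \<inter> W))"
proof -
  have "openin (top_of_set (snd c ` fst c)) (snd c ` (fst c \<inter> W))"
    using assms by (intro homeomorphism_imp_open_map[OF homeomorphism_chart]) (auto simp: openin_open)
  moreover have "open (snd c ` fst c)"
    using atlas assms(1) by (auto simp: smooth_atlas_def)
  ultimately show ?thesis
    using openin_open_trans by blast
qed

lemma smooth_on_transition:
  "c \<in> A \<Longrightarrow> d \<in> A \<Longrightarrow> smooth_on (snd c ` (fst c \<inter> fst d)) (snd d \<circ> chart_inv c)"
  using atlas by (simp add: smooth_atlas_def)

lemma transition_has_derivative:
  assumes "c \<in> A" "d \<in> A" "p \<in> fst c" "p \<in> fst d"
  shows "((snd d \<circ> chart_inv c) has_derivative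
    frechet_derivative (snd d \<circ> chart_inv c) (at (snd c p))) (at (snd c p))"
  using smooth_on_differentiable[OF smooth_on_transition[OF assms(1,2)]] assms
  by (auto simp: frechet_derivative_works)

text \<open>The chain rule. The transition maps compose correctly only on the image of the overlap
  of \<open>c\<close> and \<open>d\<close>, so the derivative is transferred along this open
  set.\<close>

lemma jac_trans:
  assumes "c \<in> A" "d \<in> A" "e \<in> A" "p \<in> fst c" "p \<in> fst d" "p \<in> fst e"
  shows "jac d e p ** jac c d p = (jac c e p :: 'a::real_normed_field^'n^'n)"
proof -
  let ?D = "\<lambda>c d. frechet_derivative (snd d \<circ> chart_inv c) (at (snd c p))"
  let ?U = "snd c ` (fst c \<inter> fst d)"
  have x: "(snd d \<circ> chart_inv c) (snd c p) = snd d p"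
    using assms by (simp add: chart_inv_chart)
  have "((snd e \<circ> chart_inv d) \<circ> (snd d \<circ> chart_inv c) has_derivative ?D d e \<circ> ?D c d) (at (snd c p))"
    by (rule diff_chain_at) (simp_all only: x transition_has_derivative assms)
  moreover have "open ?U" "snd c p \<in> ?U"
    using open_chart_image[OF assms(1) open_chart[OF assms(2)]] assms by auto
  moreover have "((snd e \<circ> chart_inv d) \<circ> (snd d \<circ> chart_inv c)) y = (snd e \<circ> chart_inv c) y" if "y \<in> ?U" for y
    using that assms by (auto simp: chart_inv_chart)
  ultimately have "(snd e \<circ> chart_inv c has_derivative ?D d e \<circ> ?D c d) (at (snd c p))"
    by (rule has_derivative_transform_within_open)
  then have "?D c e = ?D d e \<circ> ?D c d"
    by (rule frechet_derivative_at[symmetric])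
  moreover have "linear (?D c d)" "linear (?D d e)"
    using transition_has_derivative assms by (blast intro: has_derivative_linear)+
  ultimately have "matrix (?D c e) = matrix (?D d e) ** matrix (?D c d)"
    by (simp add: matrix_compose)
  then show ?thesis
    by (simp add: jac_def map_matrix_of_real_mult)
qed

lemma jac_self:
  assumes "c \<in> A" "p \<in> fst c"
  shows "jac c c p = (mat 1 :: 'a::real_normed_field^'n^'n)"
proof -
  have "(snd c \<circ> chart_inv c has_derivative (\<lambda>v. v)) (at (snd c p))"
  proof (rule has_derivative_transform_within_open[OF has_derivative_ident])
    show "open (snd c ` (fst c \<inter> UNIV))"
      using assms by (intro open_chart_image) auto
  qed (use assms in \<open>auto simp: chart_inv_chart\<close>)
  then have "matrix (frechet_derivative (snd c \<circ> chart_inv c) (at (snd c p))) = mat 1"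
    by (simp add: frechet_derivative_at[symmetric] matrix_id_mat_1[unfolded id_def])
  then show ?thesis
    by (simp add: jac_def map_matrix_def mat_def vec_eq_iff)
qed

lemma jac_inverse:
  assumes "c \<in> A" "d \<in> A" "p \<in> fst c" "p \<in> fst d"
  shows "jac d c p ** jac c d p = (mat 1 :: 'a::real_normed_field^'n^'n)"
  using assms by (simp add: jac_trans jac_self)

lemma smooth_on_jac:
  assumes "c \<in> A" "d \<in> A"
  shows "smooth_on (snd c ` (fst c \<inter> fst d))
    (\<lambda>x. jac c d (chart_inv c x) :: 'a::{real_normed_field,euclidean_space}^'n^'n)"
proof -
  have U: "open (snd c ` (fst c \<inter> fst d))"
    using assms open_chart open_chart_image by blast
  have "linear (of_real :: real \<Rightarrow> 'a)"
    by (simp add: linear_iff scaleR_conv_of_real)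
  then have "smooth_on (snd c ` (fst c \<inter> fst d))
      (\<lambda>x. of_real (frechet_derivative (snd d \<circ> chart_inv c) (at x) (axis j 1) $ i) :: 'a)" for i j
    by (rule smooth_on_linear[OF U _ smooth_on_vec_nth[OF U smooth_on_frechet_derivative[OF
            smooth_on_transition[OF assms]]]])
  then have "smooth_on (snd c ` (fst c \<inter> fst d)) (\<lambda>x. jac c d (chart_inv c x) $ i $ j :: 'a)" for i j
    by (rule smooth_on_cong[OF U])
       (use assms in \<open>auto simp: jac_def map_matrix_def matrix_def chart_inv_chart\<close>)
  then show ?thesis
    by (intro smooth_on_vec[OF U])
qed

lemma change_chart_trans:
  assumes "c \<in> A" "d \<in> A" "e \<in> A" "p \<in> fst c" "p \<in> fst d" "p \<in> fst e"
  shows "change_chart d e p (change_chart c d p v) = change_chart c e p v"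
  using assms
  by (simp add: change_chart_def matrix_vector_mul_assoc vector_matrix_mul_assoc jac_trans)

lemma change_chart_self:
  "c \<in> A \<Longrightarrow> p \<in> fst c \<Longrightarrow> change_chart c c p v = v"
  by (simp add: change_chart_def jac_self)

lemma change_chart_graph:
  assumes "c \<in> A" "d \<in> A" "p \<in> fst c" "p \<in> fst d"
  shows "change_chart c d p (sharp P \<xi>, \<xi>) =
    (sharp (jac c d p ** P ** transpose (jac c d p)) (transpose (jac d c p) *v \<xi>), transpose (jac d c p) *v \<xi>)"
  by (simp only: change_chart_def fst_conv snd_conv sharp_congruence[OF jac_inverse[OF assms]])

lemma section_rep_chart:
  "c \<in> A \<Longrightarrow> p \<in> fst c \<Longrightarrow> section_rep A c e (snd c p) = change_chart (chart_at A p) c p (e p)"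
  by (simp add: section_rep_def chart_inv_chart Let_def)

lemma bivector_rep_chart:
  "c \<in> A \<Longrightarrow> p \<in> fst c \<Longrightarrow> bivector_rep A c \<pi> (snd c p) =
    jac (chart_at A p) c p ** \<pi> p ** transpose (jac (chart_at A p) c p)"
  by (simp add: bivector_rep_def chart_inv_chart Let_def)

lemma bivector_rep_chart_at: "bivector_rep A (chart_at A p) \<pi> (snd (chart_at A p) p) = \<pi> p"
  by (simp add: bivector_rep_chart jac_self chart_at_in_atlas in_chart_at)

lemma transpose_bivector_rep:
  fixes \<pi> :: "'m \<Rightarrow> 'a::real_normed_field^'n^'n"
  assumes "transpose (\<pi> (chart_inv c x)) = - \<pi> (chart_inv c x)"
  shows "transpose (bivector_rep A c \<pi> x) = - bivector_rep A c \<pi> x"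
proof -
  have "J ** - P ** K = - (J ** P ** K)" for J P K :: "'a^'n^'n"
    by (simp add: vec_eq_iff matrix_matrix_mult_def sum_negf)
  then show ?thesis
    using assms by (simp add: bivector_rep_def Let_def matrix_transpose_mul matrix_mul_assoc)
qed

text \<open>A section of the graph of \<open>\<pi>\<close> is represented in every chart by a
  section of the graph of the representative of \<open>\<pi>\<close>; this carries graph conditions
  over to coordinates.\<close>

lemma section_rep_graph:
  assumes "c \<in> A" "p \<in> fst c"
  shows "section_rep A c (\<lambda>q. (sharp (\<pi> q) (\<xi> q), \<xi> q)) (snd c p) =
    (sharp (bivector_rep A c \<pi> (snd c p)) (transpose (jac c (chart_at A p) p) *v \<xi> p),
     transpose (jac c (chart_at A p) p) *v \<xi> p)"
  using assms
  by (simp add: section_rep_chart bivector_rep_chart chart_at_in_atlas in_chart_at change_chart_graph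
      del: transpose_matrix_vector)

section \<open>Graphs as smooth, lagrangian and involutive subbundles\<close>

text \<open>A local frame is obtained by lifting the coordinate forms of one chart around
  \<open>p\<close> along the map \<xi> to (\<open>sharp\<close> of \<xi>, \<xi>); the rank is the
  dimension of the manifold.\<close>

lemma smooth_subbundle_bivector_graph:
  fixes \<pi> :: "'m \<Rightarrow> 'a::{real_normed_field,euclidean_space}^'n^'n"
  assumes "bivector_field A \<pi>"
  shows "smooth_subbundle A (bivector_graph \<pi>)"
  unfolding smooth_subbundle_def
proof (intro exI[of _ "CARD('n)"] allI)
  fix p
  let ?c = "chart_at A p"
  note c = chart_at_in_atlas[of p]
  obtain h :: "nat \<Rightarrow> 'n" where h: "bij_betw h {..<CARD('n)} UNIV"
    using ex_bij_betw_nat_finite[of "UNIV :: 'n set"] by (auto simp: atLeast0LessThan)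
  \<comment> \<open>The \<open>i\<close>-th coordinate form of the chart \<open>?c\<close>, written
    at \<open>q\<close> in the components of \<open>chart_at A q\<close>.\<close>
  define \<xi> :: "'n \<Rightarrow> 'm \<Rightarrow> 'a^'n" where "\<xi> i q = axis i 1 v* jac (chart_at A q) ?c q" for i q
  define e where "e k q = (sharp (\<pi> q) (\<xi> (h k) q), \<xi> (h k) q)" for k q
  have "smooth_section_on A (fst ?c) (e k)" for k
    unfolding smooth_section_on_def
  proof
    fix d assume d: "d \<in> A"
    let ?U = "snd d ` (fst d \<inter> fst ?c)"
    let ?\<zeta> = "\<lambda>x. axis (h k) 1 v* (jac d ?c (chart_inv d x) :: 'a^'n^'n)"
    have U: "open ?U"
      by (intro open_chart_image open_chart c d)
    have \<pi>: "smooth_on ?U (bivector_rep A d \<pi>)"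
      using assms d by (auto simp: bivector_field_def intro: smooth_on_subset)
    have "smooth_on ?U (\<lambda>x. (?\<zeta> x v* bivector_rep A d \<pi> x, ?\<zeta> x))"
      by (intro smooth_on_Pair smooth_on_vector_matrix_mult smooth_on_const smooth_on_jac \<pi> U c d)
    then show "smooth_on ?U (section_rep A d (e k))"
    proof (rule smooth_on_cong[OF U])
      fix x assume "x \<in> ?U"
      then obtain q where q: "q \<in> fst d" "q \<in> fst ?c" "x = snd d q"
        by auto
      \<comment> \<open>The chart \<open>chart_at A q\<close> may jump as \<open>q\<close> varies.
        By the chain rule it drops out, leaving the Jacobian between the fixed charts
        \<open>d\<close> and \<open>?c\<close>, which is smooth.\<close>
      have "transpose (jac d (chart_at A q) q) *v \<xi> (h k) q = ?\<zeta> x"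
        using q c d
        by (simp add: \<xi>_def vector_matrix_mul_assoc jac_trans chart_at_in_atlas in_chart_at chart_inv_chart)
      then show "(?\<zeta> x v* bivector_rep A d \<pi> x, ?\<zeta> x) = section_rep A d (e k) x"
        unfolding e_def q(3) section_rep_graph[OF d q(1)] by (simp only: sharp_def)
    qed
  qed
  moreover have "inj_on (\<lambda>k. e k q) {..<CARD('n)} \<and> gtangent.independent ((\<lambda>k. e k q) ` {..<CARD('n)}) \<and>
      gtangent.span ((\<lambda>k. e k q) ` {..<CARD('n)}) = bivector_graph \<pi> q" if q: "q \<in> fst ?c" for q
  proof -
    interpret vector_space_pair "(*s) :: 'a \<Rightarrow> 'a^'n \<Rightarrow> 'a^'n" "gscale :: 'a \<Rightarrow> ('a, 'n) gtangent \<Rightarrow> _"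
      by unfold_locales
    let ?M = "jac (chart_at A q) ?c q :: 'a^'n^'n" and ?K = "jac ?c (chart_at A q) q :: 'a^'n^'n"
    have M: "?M ** ?K = mat 1" "?K ** ?M = mat 1"
      using q c by (simp_all add: jac_inverse chart_at_in_atlas in_chart_at)
    \<comment> \<open>\<open>T\<close> parametrizes the fibre of the graph linearly and injectively
      and sends the standard basis to the frame at \<open>q\<close>, so independence and span carry
      over from that basis.\<close>
    define T where "T \<alpha> = (sharp (\<pi> q) (\<alpha> v* ?M), \<alpha> v* ?M)" for \<alpha>
    have T: "Vector_Spaces.linear (*s) gscale T"
      unfolding Vector_Spaces.linear_iff
      by (simp add: vec.vector_space_axioms gtangent.vector_space_axioms T_def gscale_def sharp_def vector_matrix_left_distrib scalar_vector_matrix_assoc)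
    have "inj T"
    proof (rule injI)
      fix \<alpha> \<beta> assume "T \<alpha> = T \<beta>"
      then have "\<alpha> v* ?M v* ?K = \<beta> v* ?M v* ?K"
        by (simp add: T_def)
      then show "\<alpha> = \<beta>"
        by (simp add: vector_matrix_mul_assoc M)
    qed
    have "T (\<alpha> v* ?K) = (sharp (\<pi> q) \<alpha>, \<alpha>)" for \<alpha>
      by (simp add: T_def vector_matrix_mul_assoc M)
    then have "range T = bivector_graph \<pi> q"
      by (auto simp: bivector_graph_def T_def image_iff) metis
    have e: "(\<lambda>k. e k q) = T \<circ> (\<lambda>i. axis i 1) \<circ> h"
      by (auto simp: e_def T_def \<xi>_def)
    have "(\<lambda>k. e k q) ` {..<CARD('n)} = T ` (\<lambda>i. axis i 1) ` h ` {..<CARD('n)}"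
      unfolding e by (simp only: image_comp comp_assoc)
    also have "h ` {..<CARD('n)} = UNIV"
      using h by (simp add: bij_betw_def)
    also have "range (\<lambda>i. axis i 1) = (cart_basis :: ('a^'n) set)"
      by (auto simp: cart_basis_def)
    finally have image: "(\<lambda>k. e k q) ` {..<CARD('n)} = T ` cart_basis" .
    have "inj_on (\<lambda>k. e k q) {..<CARD('n)}"
      unfolding e
    proof (intro comp_inj_on)
      show "inj_on h {..<CARD('n)}"
        using h by (simp add: bij_betw_def)
      show "inj_on (\<lambda>i. axis i 1 :: 'a^'n) (h ` {..<CARD('n)})"
        by (auto simp: inj_on_def axis_eq_axis)
      show "inj_on T ((\<lambda>i. axis i 1) ` h ` {..<CARD('n)})"
        using \<open>inj T\<close> by (rule inj_on_subset) simp
    qed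
    moreover have "gtangent.independent (T ` cart_basis)"
      by (rule linear_independent_injective_image[OF T vec.independent_Basis])
         (use \<open>inj T\<close> in \<open>auto intro: inj_on_subset\<close>)
    moreover have "gtangent.span (T ` cart_basis) = bivector_graph \<pi> q"
      using linear_span_image[OF T, of cart_basis] \<open>range T = _\<close> by (simp add: vec.span_Basis)
    ultimately show ?thesis
      by (simp add: image)
  qed
  ultimately show "\<exists>W. open W \<and> p \<in> W \<and> (\<exists>e. (\<forall>i<CARD('n). smooth_section_on A W (e i)) \<and>
      (\<forall>q\<in>W. inj_on (\<lambda>i. e i q) {..<CARD('n)} \<and>
         gtangent.independent ((\<lambda>i. e i q) ` {..<CARD('n)}) \<and>
         gtangent.span ((\<lambda>i. e i q) ` {..<CARD('n)}) = bivector_graph \<pi> q))"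
    using open_chart[OF c] in_chart_at by (intro exI[of _ "fst ?c"] conjI exI[of _ e]) auto
qed

end

lemma contract_sharp:
  fixes P :: "'a::comm_ring_1^'n^'n::finite"
  assumes "transpose P = - P"
  shows "contract \<alpha> (sharp P \<xi>) = - contract \<xi> (sharp P \<alpha>)"
proof -
  have "contract \<alpha> (sharp P \<xi>) = (\<Sum>j\<in>UNIV. \<Sum>i\<in>UNIV. \<alpha> $ j * \<xi> $ i * P $ i $ j)"
    by (simp add: contract_def sharp_def vector_matrix_mult_def sum_distrib_left mult_ac)
  also have "\<dots> = (\<Sum>i\<in>UNIV. \<Sum>j\<in>UNIV. - (\<xi> $ i * \<alpha> $ j * P $ j $ i))"
    by (subst sum.swap, intro sum.cong refl, subst skew_nth[OF assms]) (simp add: mult_ac)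
  also have "\<dots> = - contract \<xi> (sharp P \<alpha>)"
    by (simp add: contract_def sharp_def vector_matrix_mult_def sum_distrib_left mult_ac sum_negf)
  finally show ?thesis .
qed

text \<open>Skewness gives isotropy. Conversely, orthogonality to the whole graph, tested on the
  coordinate covectors, determines the vector part of \<open>v\<close> and forces it to be the sharp
  of its covector part; no dimension count enters.\<close>

lemma lagrangian_bivector_graph:
  fixes \<pi> :: "'m \<Rightarrow> 'a::comm_ring_1^'n^'n::finite"
  assumes "transpose (\<pi> p) = - \<pi> p"
  shows "lagrangian (bivector_graph \<pi> p)"
proof -
  have "v \<in> bivector_graph \<pi> p \<longleftrightarrow> (\<forall>w\<in>bivector_graph \<pi> p. pairing v w = 0)" for v :: "('a, 'n) gtangent"
  proof
    assume "v \<in> bivector_graph \<pi> p"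
    then obtain \<xi> where v: "v = (sharp (\<pi> p) \<xi>, \<xi>)"
      by (auto simp: bivector_graph_def)
    have "pairing v (sharp (\<pi> p) \<alpha>, \<alpha>) = 0" for \<alpha>
      using contract_sharp[OF assms, of \<alpha> \<xi>] by (simp add: pairing_def v)
    then show "\<forall>w\<in>bivector_graph \<pi> p. pairing v w = 0"
      by (auto simp: bivector_graph_def)
  next
    assume *: "\<forall>w\<in>bivector_graph \<pi> p. pairing v w = 0"
    have "contract \<alpha> (fst v) = contract \<alpha> (sharp (\<pi> p) (snd v))" for \<alpha>
    proof -
      have "pairing v (sharp (\<pi> p) \<alpha>, \<alpha>) = 0"
        using * by (auto simp: bivector_graph_def)
      then show ?thesis
        by (simp add: pairing_def contract_sharp[OF assms, of "snd v"])
    qed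
    from this[of "axis _ 1"] have "fst v = sharp (\<pi> p) (snd v)"
      by (simp add: contract_def axis_def vec_eq_iff if_distrib if_distribR cong: if_cong)
    then show "v \<in> bivector_graph \<pi> p"
      unfolding bivector_graph_def by (metis (mono_tags, lifting) mem_Collect_eq prod.collapse)
  qed
  then show ?thesis
    unfolding lagrangian_def by blast
qed

lemma involutive_bivector_graph:
  fixes \<pi> :: "'m::{t2_space,second_countable_topology} \<Rightarrow> 'a::{real_normed_field,euclidean_space}^'n^'n::finite"
  assumes atlas: "smooth_atlas A" and poisson: "poisson A \<pi>"
  shows "involutive A (bivector_graph \<pi>)"
  unfolding involutive_def
proof (intro allI impI)
  fix e f :: "'m \<Rightarrow> ('a, 'n) gtangent" and p
  assume smooth: "smooth_section_on A UNIV e" "smooth_section_on A UNIV f"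
    and graph: "\<forall>p. e p \<in> bivector_graph \<pi> p" "\<forall>p. f p \<in> bivector_graph \<pi> p"
  let ?c = "chart_at A p"
  let ?U = "snd ?c ` fst ?c" and ?x = "snd ?c p" and ?P = "bivector_rep A ?c \<pi>"
  note c = chart_at_in_atlas[OF atlas, of p]
  have U: "open ?U" "?x \<in> ?U"
    using open_chart_image[OF atlas c open_UNIV] in_chart_at[OF atlas] by auto
  have rep: "fst (section_rep A ?c g y) = sharp (?P y) (snd (section_rep A ?c g y))"
    if "\<forall>p. g p \<in> bivector_graph \<pi> p" "y \<in> ?U" for g y
  proof -
    have "g q = (sharp (\<pi> q) (snd (g q)), snd (g q))" for q
      using that(1)[rule_format, of q] by (auto simp: bivector_graph_def)
    then have "g = (\<lambda>q. (sharp (\<pi> q) (snd (g q)), snd (g q)))"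
      by (rule ext)
    moreover obtain q where "q \<in> fst ?c" "y = snd ?c q"
      using \<open>y \<in> ?U\<close> by auto
    ultimately show ?thesis
      using section_rep_graph[OF atlas c, of q \<pi> "\<lambda>q. snd (g q)"] by simp
  qed
  have diff: "(\<lambda>y. snd (section_rep A ?c g y) $ i) differentiable (at ?x)"
    if "smooth_section_on A UNIV g" for g :: "'m \<Rightarrow> ('a, 'n) gtangent" and i
  proof -
    have "smooth_on ?U (section_rep A ?c g)"
      using that c by (auto simp: smooth_section_on_def)
    then have "smooth_on ?U (\<lambda>y. snd (section_rep A ?c g y) $ i)"
      by (intro smooth_on_vec_nth[OF U(1)] smooth_on_linear[OF U(1) linear_snd])
    then show ?thesis
      using U(2) by (rule smooth_on_differentiable)
  qed
  have \<pi>: "bivector_field A \<pi>"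
    using poisson by (simp add: poisson_def)
  have "fst (courant A e f p) = sharp (?P ?x) (snd (courant A e f p))"
    unfolding courant_def Let_def
  proof (rule courant_local_in_graph[OF U])
    show "(\<lambda>y. ?P y $ i $ j) differentiable (at ?x)" for i j
      using \<pi> c by (intro smooth_on_differentiable[OF _ U(2)] smooth_on_vec_nth[OF U(1)])
        (auto simp: bivector_field_def)
    show "transpose (?P y) = - ?P y" for y
      using \<pi> by (intro transpose_bivector_rep[OF atlas]) (simp add: bivector_field_def)
    show "schouten_local ?P ?P ?x = 0"
      using poisson by (simp add: poisson_def schouten_def Let_def)
  qed (simp_all add: rep diff smooth graph)
  \<comment> \<open>At its own base point the representative in \<open>chart_at A p\<close> is
    \<open>\<pi> p\<close> itself, so the coordinate statement is already the condition on the
    fibre.\<close>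
  then show "courant A e f p \<in> bivector_graph \<pi> p"
    unfolding bivector_rep_chart_at[OF atlas] bivector_graph_def
    by (metis (mono_tags, lifting) mem_Collect_eq prod.collapse)
qed

section \<open>The generalized complex map\<close>

lemma linear_sharp: "linear (sharp P)" for P :: "real^'n^'n::finite"
  unfolding sharp_def transpose_matrix_vector[symmetric] by (rule matrix_vector_mul_linear)

lemma bij_sharp_iff: "bij (sharp P) \<longleftrightarrow> (\<forall>\<xi>. sharp P \<xi> = 0 \<longrightarrow> \<xi> = 0)" for P :: "real^'n^'n::finite"
  unfolding bij_def using linear_injective_imp_surjective[OF linear_sharp] linear_injective_0[OF linear_sharp]
  by blast

lemma invertible_iff_bij_sharp: "invertible P \<longleftrightarrow> bij (sharp P)" for P :: "real^'n^'n::finite"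
proof
  assume "invertible P"
  then have "\<xi> = 0" if "sharp P \<xi> = 0" for \<xi>
    using arg_cong[OF that, of "\<lambda>X. X v* matrix_inv P"]
    by (simp add: sharp_def vector_matrix_mul_assoc matrix_inv_mult)
  then show "bij (sharp P)"
    by (simp add: bij_sharp_iff)
next
  assume "bij (sharp P)"
  moreover have "(*v) (transpose P) = sharp P"
    by (simp add: fun_eq_iff sharp_def)
  ultimately have "inj ((*v) (transpose P))"
    by (simp add: bij_def)
  then have "invertible (transpose P)"
    by (simp add: matrix_left_invertible_injective invertible_left_inverse)
  then show "invertible P"
    using transpose_invertible[of "transpose P"] by simp
qed

lemma inv_sharp:
  fixes P :: "real^'n^'n::finite"
  assumes "invertible P"
  shows "inv (sharp P) = sharp (matrix_inv P)"
  using assms by (intro inv_equality) (simp_all add: sharp_def vector_matrix_mul_assoc matrix_inv_mult)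

section \<open>Real and imaginary parts of elements of the graph\<close>

lemma gComplex_exhaust: obtains v w where "z = gComplex v w"
proof -
  have "z = gComplex (\<chi> i. Re (fst z $ i), \<chi> i. Re (snd z $ i)) (\<chi> i. Im (fst z $ i), \<chi> i. Im (snd z $ i))"
    by (simp add: gComplex_def prod_eq_iff vec_eq_iff)
  then show thesis
    by (rule that)
qed

text \<open>These two real equations are the source of both the intersection criterion and the
  formula for the generalized complex map.\<close>

lemma gComplex_mem_bivector_graph:
  "gComplex v w \<in> bivector_graph (complex_bivector \<pi>\<^sub>1 \<pi>\<^sub>2) p \<longleftrightarrow>
    fst v = sharp (\<pi>\<^sub>1 p) (snd v) - sharp (\<pi>\<^sub>2 p) (snd w) \<and>
    fst w = sharp (\<pi>\<^sub>2 p) (snd v) + sharp (\<pi>\<^sub>1 p) (snd w)"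
proof -
  have "gComplex v w \<in> bivector_graph (complex_bivector \<pi>\<^sub>1 \<pi>\<^sub>2) p \<longleftrightarrow>
      fst (gComplex v w) = sharp (complex_bivector \<pi>\<^sub>1 \<pi>\<^sub>2 p) (snd (gComplex v w))"
    unfolding bivector_graph_def by (auto simp: prod_eq_iff)
  also have "\<dots> \<longleftrightarrow> fst v = sharp (\<pi>\<^sub>1 p) (snd v) - sharp (\<pi>\<^sub>2 p) (snd w) \<and>
      fst w = sharp (\<pi>\<^sub>2 p) (snd v) + sharp (\<pi>\<^sub>1 p) (snd w)"
    unfolding gComplex_def fst_conv snd_conv sharp_complex_bivector
    by (simp only: vec_eq_iff vec_lambda_beta complex.inject) blast
  finally show ?thesis .
qed

text \<open>An element v + iw lies in the graph together with its conjugate exactly when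
  \<open>v\<close> and \<open>w\<close> are both real points of the graph, that is, when their
  covector parts lie in the kernel of \<open>\<pi>\<^sub>2\<close> and fix their vector parts.
  Nonzero intersections thus correspond to a nonzero kernel.\<close>

lemma bivector_graph_inter_gcnj:
  fixes \<pi>\<^sub>1 \<pi>\<^sub>2 :: "'m \<Rightarrow> real^'n^'n::finite"
  shows "bivector_graph (complex_bivector \<pi>\<^sub>1 \<pi>\<^sub>2) p \<inter> gcnj ` bivector_graph (complex_bivector \<pi>\<^sub>1 \<pi>\<^sub>2) p = {0}
    \<longleftrightarrow> bij (sharp (\<pi>\<^sub>2 p))"
proof -
  let ?L = "bivector_graph (complex_bivector \<pi>\<^sub>1 \<pi>\<^sub>2) p"
  have neg: "sharp P (- \<xi>) = - sharp P \<xi>" for P :: "real^'n^'n" and \<xi>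
    by (rule linear_neg[OF linear_sharp])
  have zero: "sharp P 0 = 0" for P :: "real^'n^'n"
    by (rule linear_0[OF linear_sharp])
  have cnj: "gcnj (gComplex v w) = gComplex v (- w)" for v w :: "(real, 'n) gtangent"
    by (simp add: gcnj_def gComplex_def vec_eq_iff complex_eq_iff)
  have mem_cnj: "z \<in> gcnj ` ?L \<longleftrightarrow> gcnj z \<in> ?L" for z
  proof -
    have "gcnj (gcnj z) = z" for z :: "(complex, 'n) gtangent"
      by (simp add: gcnj_def vec_eq_iff prod_eq_iff)
    then show ?thesis
      using image_eqI[of z gcnj "gcnj z" ?L] by auto
  qed
  \<comment> \<open>Compares the two real equations for v + iw with those for v - iw: adding and
    subtracting isolates the terms with \<open>\<pi>\<^sub>2\<close>.\<close>
  have split: "(a = b - c \<and> d = e + f) \<and> (a = b + c \<and> - d = e - f) \<longleftrightarrow> a = b \<and> d = f \<and> e = 0 \<and> c = 0"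
    for a b c d e f :: "real^'n"
  proof
    assume *: "(a = b - c \<and> d = e + f) \<and> (a = b + c \<and> - d = e - f)"
    then have "b - c = b + c" "- (e + f) = e - f"
      by auto
    then have "c = 0" "e = 0"
      by (simp_all add: vec_eq_iff)
    then show "a = b \<and> d = f \<and> e = 0 \<and> c = 0"
      using * by simp
  qed simp
  have "gComplex v w \<in> ?L \<inter> gcnj ` ?L \<longleftrightarrow> fst v = sharp (\<pi>\<^sub>1 p) (snd v) \<and> fst w = sharp (\<pi>\<^sub>1 p) (snd w)
      \<and> sharp (\<pi>\<^sub>2 p) (snd v) = 0 \<and> sharp (\<pi>\<^sub>2 p) (snd w) = 0" for v w
    unfolding Int_iff mem_cnj cnj gComplex_mem_bivector_graph fst_uminus snd_uminus neg
      diff_minus_eq_add add_uminus_conv_diff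
    by (rule split)
  moreover have "gComplex v w = 0 \<longleftrightarrow> v = 0 \<and> w = 0" for v w :: "(real, 'n) gtangent"
    by (auto simp: gComplex_def zero_prod_def prod_eq_iff vec_eq_iff complex_eq_iff)
  moreover have "?L \<inter> gcnj ` ?L = {0} \<longleftrightarrow> (\<forall>v w. gComplex v w \<in> ?L \<inter> gcnj ` ?L \<longleftrightarrow> gComplex v w = 0)"
  proof
    assume *: "\<forall>v w. gComplex v w \<in> ?L \<inter> gcnj ` ?L \<longleftrightarrow> gComplex v w = 0"
    have "z \<in> ?L \<inter> gcnj ` ?L \<longleftrightarrow> z = 0" for z
    proof -
      obtain v w where z: "z = gComplex v w"
        by (rule gComplex_exhaust)
      show ?thesis
        unfolding z by (rule *[rule_format])
    qed
    then show "?L \<inter> gcnj ` ?L = {0}"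
      by blast
  qed blast
  ultimately have "?L \<inter> gcnj ` ?L = {0} \<longleftrightarrow> (\<forall>v w. fst v = sharp (\<pi>\<^sub>1 p) (snd v) \<and> fst w = sharp (\<pi>\<^sub>1 p) (snd w)
      \<and> sharp (\<pi>\<^sub>2 p) (snd v) = 0 \<and> sharp (\<pi>\<^sub>2 p) (snd w) = 0 \<longleftrightarrow> v = 0 \<and> w = 0)"
    by simp
  also have "\<dots> \<longleftrightarrow> (\<forall>\<xi>. sharp (\<pi>\<^sub>2 p) \<xi> = 0 \<longrightarrow> \<xi> = 0)"
    by (auto simp: zero_prod_def zero dest: spec[of _ 0])
  finally show ?thesis
    by (simp add: bij_sharp_iff)
qed

section \<open>The block formula for the generalized complex map\<close>

text \<open>The block matrix of the theorem applied to \<open>v\<close>. The base type is arbitrary,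
  so that the formula can also be used for coordinate representatives, with points of the chart
  image as base points.\<close>

definition gc_map :: "('m \<Rightarrow> real^'n^'n::finite) \<Rightarrow> ('m \<Rightarrow> real^'n^'n) \<Rightarrow> 'm \<Rightarrow> (real, 'n) gtangent \<Rightarrow> (real, 'n) gtangent"
  where "gc_map \<pi>\<^sub>1 \<pi>\<^sub>2 p v =
    (- sharp (\<pi>\<^sub>1 p) (inv (sharp (\<pi>\<^sub>2 p)) (fst v))
       + (sharp (\<pi>\<^sub>1 p) (inv (sharp (\<pi>\<^sub>2 p)) (sharp (\<pi>\<^sub>1 p) (snd v))) + sharp (\<pi>\<^sub>2 p) (snd v)),
     - inv (sharp (\<pi>\<^sub>2 p)) (fst v) + inv (sharp (\<pi>\<^sub>2 p)) (sharp (\<pi>\<^sub>1 p) (snd v)))"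

text \<open>The first real equation is solved for the covector part of \<open>w\<close> by inverting
  \<open>\<pi>\<^sub>2\<close>; the second then yields the vector part. This uniqueness is what
  later arguments about \<open>gc_map\<close> use in place of the block formula.\<close>

lemma gComplex_mem_graph_iff_gc_map:
  assumes "bij (sharp (\<pi>\<^sub>2 p))"
  shows "gComplex v w \<in> bivector_graph (complex_bivector \<pi>\<^sub>1 \<pi>\<^sub>2) p \<longleftrightarrow> w = gc_map \<pi>\<^sub>1 \<pi>\<^sub>2 p v"
proof -
  have linear: "linear (inv (sharp (\<pi>\<^sub>2 p)))" 
    using assms by (simp add: linear_sharp inv_sharp flip: invertible_iff_bij_sharp)
  have "fst v = sharp (\<pi>\<^sub>1 p) (snd v) - sharp (\<pi>\<^sub>2 p) (snd w) \<longleftrightarrow>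
      sharp (\<pi>\<^sub>2 p) (snd w) = sharp (\<pi>\<^sub>1 p) (snd v) - fst v"
    by (auto simp: algebra_simps)
  also have "\<dots> \<longleftrightarrow> snd w = inv (sharp (\<pi>\<^sub>2 p)) (sharp (\<pi>\<^sub>1 p) (snd v) - fst v)"
    using assms by (metis bij_inv_eq_iff)
  also have "inv (sharp (\<pi>\<^sub>2 p)) (sharp (\<pi>\<^sub>1 p) (snd v) - fst v) = snd (gc_map \<pi>\<^sub>1 \<pi>\<^sub>2 p v)"
    by (simp add: linear_diff[OF linear] gc_map_def)
  finally have "gComplex v w \<in> bivector_graph (complex_bivector \<pi>\<^sub>1 \<pi>\<^sub>2) p \<longleftrightarrow>
      snd w = snd (gc_map \<pi>\<^sub>1 \<pi>\<^sub>2 p v) \<and>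
      fst w = sharp (\<pi>\<^sub>2 p) (snd v) + sharp (\<pi>\<^sub>1 p) (snd (gc_map \<pi>\<^sub>1 \<pi>\<^sub>2 p v))"
    by (auto simp: gComplex_mem_bivector_graph)
  also have "sharp (\<pi>\<^sub>2 p) (snd v) + sharp (\<pi>\<^sub>1 p) (snd (gc_map \<pi>\<^sub>1 \<pi>\<^sub>2 p v)) = fst (gc_map \<pi>\<^sub>1 \<pi>\<^sub>2 p v)"
    by (simp add: gc_map_def linear_diff[OF linear_sharp])
  finally show ?thesis
    by (auto simp: prod_eq_iff)
qed

lemma gc_map_gc_map:
  assumes "bij (sharp (\<pi>\<^sub>2 p))"
  shows "gc_map \<pi>\<^sub>1 \<pi>\<^sub>2 p (gc_map \<pi>\<^sub>1 \<pi>\<^sub>2 p v) = - v"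
proof -
  have "gComplex v (gc_map \<pi>\<^sub>1 \<pi>\<^sub>2 p v) \<in> bivector_graph (complex_bivector \<pi>\<^sub>1 \<pi>\<^sub>2) p"
    using gComplex_mem_graph_iff_gc_map[where \<pi>\<^sub>2 = \<pi>\<^sub>2 and p = p, OF assms] by blast
  \<comment> \<open>The graph is a complex subspace: multiplying v + iJv by -i gives Jv - iv, which
    lies in the graph again.\<close>
  then have "gComplex (gc_map \<pi>\<^sub>1 \<pi>\<^sub>2 p v) (- v) \<in> bivector_graph (complex_bivector \<pi>\<^sub>1 \<pi>\<^sub>2) p"
    by (simp add: gComplex_mem_bivector_graph linear_neg[OF linear_sharp])
  then show ?thesis
    using gComplex_mem_graph_iff_gc_map[where \<pi>\<^sub>2 = \<pi>\<^sub>2 and p = p, OF assms] by metis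
qed

lemma pairing_gc_map:
  fixes \<pi>\<^sub>1 \<pi>\<^sub>2 :: "'m \<Rightarrow> real^'n^'n::finite"
  assumes "bij (sharp (\<pi>\<^sub>2 p))" "transpose (\<pi>\<^sub>1 p) = - \<pi>\<^sub>1 p" "transpose (\<pi>\<^sub>2 p) = - \<pi>\<^sub>2 p"
  shows "pairing (gc_map \<pi>\<^sub>1 \<pi>\<^sub>2 p v) (gc_map \<pi>\<^sub>1 \<pi>\<^sub>2 p w) = pairing v w"
proof -
  let ?J = "gc_map \<pi>\<^sub>1 \<pi>\<^sub>2 p"
  have "lagrangian (bivector_graph (complex_bivector \<pi>\<^sub>1 \<pi>\<^sub>2) p)"
    by (intro lagrangian_bivector_graph transpose_complex_bivector assms)
  moreover have "gComplex v (?J v) \<in> bivector_graph (complex_bivector \<pi>\<^sub>1 \<pi>\<^sub>2) p" for v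
    using gComplex_mem_graph_iff_gc_map[where \<pi>\<^sub>2 = \<pi>\<^sub>2 and p = p, OF assms(1)] by blast
  ultimately have "pairing (gComplex v (?J v)) (gComplex w (?J w)) = 0"
    unfolding lagrangian_def by blast
  then have "Re (pairing (gComplex v (?J v)) (gComplex w (?J w))) = 0"
    by simp
  moreover have "Re (pairing (gComplex v v') (gComplex w w')) = pairing v w - pairing v' w'"
    for v v' w w' :: "(real, 'n) gtangent"
    by (simp add: pairing_def gComplex_def contract_def sum_subtractf)
  ultimately show ?thesis
    by simp
qed

text \<open>Jacobians of coordinate changes are real, so real and imaginary parts transform
  separately.\<close>

lemma bivector_rep_complex_bivector:
  "bivector_rep A c (complex_bivector \<pi>\<^sub>1 \<pi>\<^sub>2) = complex_bivector (bivector_rep A c \<pi>\<^sub>1) (bivector_rep A c \<pi>\<^sub>2)"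
  by (rule ext) (simp add: bivector_rep_def complex_bivector_def Let_def vec_eq_iff complex_eq_iff
      matrix_matrix_mult_def transpose_def jac_def map_matrix_def)

lemma invertible_bivector_rep:
  fixes \<pi> :: "'m::{t2_space,second_countable_topology} \<Rightarrow> real^'n^'n::finite"
  assumes "smooth_atlas A" "c \<in> A" "p \<in> fst c" "invertible (\<pi> p)"
  shows "invertible (bivector_rep A c \<pi> (snd c p))"
proof -
  have "invertible (jac (chart_at A p) c p :: real^'n^'n)"
    using jac_inverse[OF assms(1) chart_at_in_atlas[OF assms(1)] assms(2) in_chart_at[OF assms(1)] assms(3)]
    by (auto simp: invertible_left_inverse)
  then show ?thesis
    using assms by (simp add: bivector_rep_chart invertible_mult transpose_invertible)
qed

text \<open>The inverse of \<open>\<pi>\<^sub>2\<close> is not transformed by hand: the two real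
  graph equations are invariant under coordinate changes, and their unique solution in the new chart
  is the formula there.\<close>

lemma change_chart_gc_map:
  fixes \<pi>\<^sub>1 \<pi>\<^sub>2 :: "'m::{t2_space,second_countable_topology} \<Rightarrow> real^'n^'n::finite"
  assumes atlas: "smooth_atlas A" and c: "c \<in> A" "p \<in> fst c" and bij: "bij (sharp (\<pi>\<^sub>2 p))"
  defines "d \<equiv> chart_at A p"
  shows "change_chart d c p (gc_map \<pi>\<^sub>1 \<pi>\<^sub>2 p (change_chart c d p w)) =
    gc_map (bivector_rep A c \<pi>\<^sub>1) (bivector_rep A c \<pi>\<^sub>2) (snd c p) w"
proof -
  let ?v = "change_chart c d p w"
  let ?u = "gc_map \<pi>\<^sub>1 \<pi>\<^sub>2 p ?v"
  have d: "d \<in> A" "p \<in> fst d"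
    by (simp_all add: d_def chart_at_in_atlas in_chart_at atlas)
  have sharp: "jac d c p *v sharp (\<pi> p) (snd v) =
      sharp (bivector_rep A c \<pi> (snd c p)) (snd (change_chart d c p v))"
    for \<pi> :: "'m \<Rightarrow> real^'n^'n" and v
    unfolding bivector_rep_chart[OF atlas c] d_def[symmetric] change_chart_def snd_conv
    by (rule sharp_congruence[OF jac_inverse[OF atlas d(1) c(1) d(2) c(2)], symmetric])
  have fst: "fst (change_chart d c p v) = jac d c p *v fst v" for v :: "(real, 'n) gtangent"
    by (simp add: change_chart_def)
  have "gComplex ?v ?u \<in> bivector_graph (complex_bivector \<pi>\<^sub>1 \<pi>\<^sub>2) p"
    using gComplex_mem_graph_iff_gc_map[where \<pi>\<^sub>2 = \<pi>\<^sub>2 and p = p, OF bij] by blast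
  then have "fst ?v = sharp (\<pi>\<^sub>1 p) (snd ?v) - sharp (\<pi>\<^sub>2 p) (snd ?u)"
    "fst ?u = sharp (\<pi>\<^sub>2 p) (snd ?v) + sharp (\<pi>\<^sub>1 p) (snd ?u)"
    by (simp_all only: gComplex_mem_bivector_graph)
  then have "gComplex (change_chart d c p ?v) (change_chart d c p ?u) \<in>
      bivector_graph (complex_bivector (bivector_rep A c \<pi>\<^sub>1) (bivector_rep A c \<pi>\<^sub>2)) (snd c p)"
    unfolding gComplex_mem_bivector_graph fst
    by (simp only: matrix_vector_mult_diff_distrib matrix_vector_right_distrib sharp)
  moreover have "bij (sharp (bivector_rep A c \<pi>\<^sub>2 (snd c p)))"
    using invertible_bivector_rep[OF atlas c] bij by (simp add: invertible_iff_bij_sharp)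
  moreover have "change_chart d c p ?v = w"
    using atlas c d by (simp add: change_chart_trans change_chart_self)
  ultimately show ?thesis
    by (simp add: gComplex_mem_graph_iff_gc_map)
qed

lemma smooth_bundle_endo_gc_map:
  fixes \<pi>\<^sub>1 \<pi>\<^sub>2 :: "'m::{t2_space,second_countable_topology} \<Rightarrow> real^'n^'n::finite"
  assumes atlas: "smooth_atlas A" and \<pi>: "bivector_field A \<pi>\<^sub>1" "bivector_field A \<pi>\<^sub>2"
    and bij: "\<And>p. bij (sharp (\<pi>\<^sub>2 p))"
  shows "smooth_bundle_endo A (gc_map \<pi>\<^sub>1 \<pi>\<^sub>2)"
proof -
  have "linear (gc_map \<pi>\<^sub>1 \<pi>\<^sub>2 p)" for p
  proof -
    have "linear (inv (sharp (\<pi>\<^sub>2 p)))"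
      using bij by (simp add: linear_sharp inv_sharp flip: invertible_iff_bij_sharp)
    then show ?thesis
      by (intro linearI)
         (simp_all add: gc_map_def linear_add linear_scale linear_sharp algebra_simps)
  qed
  moreover have "smooth_on (snd c ` fst c) (\<lambda>x. let p = chart_inv c x; d = chart_at A p in
      change_chart d c p (gc_map \<pi>\<^sub>1 \<pi>\<^sub>2 p (change_chart c d p w)))" if c: "c \<in> A" for c w
  proof -
    let ?U = "snd c ` fst c" and ?P = "bivector_rep A c \<pi>\<^sub>1" and ?Q = "bivector_rep A c \<pi>\<^sub>2"
    let ?T = "\<lambda>x. matrix_inv (?Q x)"
    have U: "open ?U"
      using open_chart_image[OF atlas c open_UNIV] by simp
    have P: "smooth_on ?U ?P" and Q: "smooth_on ?U ?Q"
      using \<pi> c by (auto simp: bivector_field_def)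
    have inv: "invertible (?Q x)" if "x \<in> ?U" for x
      using that invertible_bivector_rep[OF atlas c] bij by (auto simp: invertible_iff_bij_sharp)
    have T: "smooth_on ?U ?T"
      by (intro smooth_on_matrix_inv U Q inv)
    note smooth = U P Q T smooth_on_const smooth_on_vector_matrix_mult
    \<comment> \<open>The minus signs are absorbed into the constant \<open>fst w\<close>, so only
      sums and products of smooth factors are left.\<close>
    have "smooth_on ?U (\<lambda>x. ((- fst w) v* ?T x v* ?P x + (snd w v* ?P x v* ?T x v* ?P x + snd w v* ?Q x),
        (- fst w) v* ?T x + snd w v* ?P x v* ?T x))"
      by (intro smooth_on_Pair smooth_on_add smooth)
    then show ?thesis
    proof (rule smooth_on_cong[OF U])
      fix x assume "x \<in> ?U"
      then obtain p where p: "p \<in> fst c" "x = snd c p"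
        by auto
      have neg: "(- y) v* M = - (y v* M)" for y :: "real^'n" and M :: "real^'n^'n"
        by (simp add: vec_eq_iff vector_matrix_mult_def sum_negf)
      have "(let p = chart_inv c x; d = chart_at A p in
          change_chart d c p (gc_map \<pi>\<^sub>1 \<pi>\<^sub>2 p (change_chart c d p w))) = gc_map ?P ?Q x w"
        using change_chart_gc_map[OF atlas c p(1) bij] p chart_inv_chart[OF atlas c p(1)] by (simp add: Let_def)
      also have "\<dots> = ((- fst w) v* ?T x v* ?P x + (snd w v* ?P x v* ?T x v* ?P x + snd w v* ?Q x),
          (- fst w) v* ?T x + snd w v* ?P x v* ?T x)"
        using inv_sharp[OF inv[OF \<open>x \<in> ?U\<close>]] by (simp add: gc_map_def sharp_def neg)
      finally show "((- fst w) v* ?T x v* ?P x + (snd w v* ?P x v* ?T x v* ?P x + snd w v* ?Q x),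
          (- fst w) v* ?T x + snd w v* ?P x v* ?T x) = (let p = chart_inv c x; d = chart_at A p in
          change_chart d c p (gc_map \<pi>\<^sub>1 \<pi>\<^sub>2 p (change_chart c d p w)))"
        by simp
    qed
  qed
  ultimately show ?thesis
    by (simp add: smooth_bundle_endo_def)
qed

text \<open>A map whose graph v + iJv fills the fibre must solve the graph equations, so unique
  solvability leaves only \<open>gc_map\<close>; that this map qualifies gives existence.\<close>

lemma generalized_complex_map_iff_gc_map:
  fixes \<pi>\<^sub>1 \<pi>\<^sub>2 :: "'m::{t2_space,second_countable_topology} \<Rightarrow> real^'n^'n::finite"
  assumes atlas: "smooth_atlas A" and \<pi>: "bivector_field A \<pi>\<^sub>1" "bivector_field A \<pi>\<^sub>2"
    and bij: "\<And>p. bij (sharp (\<pi>\<^sub>2 p))"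
  shows "generalized_complex_map A (bivector_graph (complex_bivector \<pi>\<^sub>1 \<pi>\<^sub>2)) J \<longleftrightarrow> J = gc_map \<pi>\<^sub>1 \<pi>\<^sub>2"
proof
  assume J: "generalized_complex_map A (bivector_graph (complex_bivector \<pi>\<^sub>1 \<pi>\<^sub>2)) J"
  have "J p v = gc_map \<pi>\<^sub>1 \<pi>\<^sub>2 p v" for p v
  proof -
    have "bivector_graph (complex_bivector \<pi>\<^sub>1 \<pi>\<^sub>2) p = {gComplex v (J p v) | v. True}"
      using J unfolding generalized_complex_map_def by blast
    then have "gComplex v (J p v) \<in> bivector_graph (complex_bivector \<pi>\<^sub>1 \<pi>\<^sub>2) p"
      by blast
    then show ?thesis
      by (simp add: gComplex_mem_graph_iff_gc_map bij)
  qed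
  then show "J = gc_map \<pi>\<^sub>1 \<pi>\<^sub>2"
    by blast
next
  have "bivector_graph (complex_bivector \<pi>\<^sub>1 \<pi>\<^sub>2) p = {gComplex v (gc_map \<pi>\<^sub>1 \<pi>\<^sub>2 p v) | v. True}" for p
  proof (intro equalityI subsetI)
    fix z assume "z \<in> bivector_graph (complex_bivector \<pi>\<^sub>1 \<pi>\<^sub>2) p"
    moreover obtain v w where z: "z = gComplex v w"
      by (rule gComplex_exhaust)
    ultimately have "w = gc_map \<pi>\<^sub>1 \<pi>\<^sub>2 p v"
      by (simp add: gComplex_mem_graph_iff_gc_map bij)
    then show "z \<in> {gComplex v (gc_map \<pi>\<^sub>1 \<pi>\<^sub>2 p v) | v. True}"
      using z by blast
  next
    fix z assume "z \<in> {gComplex v (gc_map \<pi>\<^sub>1 \<pi>\<^sub>2 p v) | v. True}"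
    then show "z \<in> bivector_graph (complex_bivector \<pi>\<^sub>1 \<pi>\<^sub>2) p"
      using gComplex_mem_graph_iff_gc_map[where \<pi>\<^sub>2 = \<pi>\<^sub>2 and p = p, OF bij] by blast
  qed
  moreover have "pairing (gc_map \<pi>\<^sub>1 \<pi>\<^sub>2 p v) (gc_map \<pi>\<^sub>1 \<pi>\<^sub>2 p w) = pairing v w" for p v w
    using \<pi> bij by (intro pairing_gc_map) (auto simp: bivector_field_def)
  moreover assume "J = gc_map \<pi>\<^sub>1 \<pi>\<^sub>2"
  ultimately show "generalized_complex_map A (bivector_graph (complex_bivector \<pi>\<^sub>1 \<pi>\<^sub>2)) J"
    using smooth_bundle_endo_gc_map[OF atlas \<pi> bij]
    by (simp add: generalized_complex_map_def gc_map_gc_map bij)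
qed

section \<open>The associated Poisson bivector\<close>

lemma transpose_matrix_inv_skew:
  fixes P :: "'a::field^'n^'n::finite"
  assumes "transpose P = - P" "invertible P"
  shows "transpose (matrix_inv P) = - matrix_inv P"
proof -
  have "transpose P ** transpose (matrix_inv P) = mat 1"
    using assms(2) by (simp add: matrix_inv_mult flip: matrix_transpose_mul)
  moreover have "- P ** Q = P ** - Q" for Q :: "'a^'n^'n"
    by (simp add: vec_eq_iff matrix_matrix_mult_def)
  ultimately have "P ** - transpose (matrix_inv P) = mat 1"
    using assms(1) by simp
  then have "matrix_inv P = - transpose (matrix_inv P)"
    by (rule matrix_inv_unique)
  then show ?thesis
    by (metis minus_minus)
qed

text \<open>The reversal of products under \<open>sharp\<close> leaves this expression unchanged,
  since its triple product reads the same in both directions.\<close>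

definition sigma_bivector :: "('m \<Rightarrow> real^'n^'n::finite) \<Rightarrow> ('m \<Rightarrow> real^'n^'n) \<Rightarrow> 'm \<Rightarrow> real^'n^'n"
  where "sigma_bivector \<pi>\<^sub>1 \<pi>\<^sub>2 p = \<pi>\<^sub>1 p ** matrix_inv (\<pi>\<^sub>2 p) ** \<pi>\<^sub>1 p + \<pi>\<^sub>2 p"

lemma sharp_sigma_bivector:
  assumes "invertible (\<pi>\<^sub>2 p)"
  shows "sharp (sigma_bivector \<pi>\<^sub>1 \<pi>\<^sub>2 p) \<xi> =
    sharp (\<pi>\<^sub>1 p) (inv (sharp (\<pi>\<^sub>2 p)) (sharp (\<pi>\<^sub>1 p) \<xi>)) + sharp (\<pi>\<^sub>2 p) \<xi>"
  by (simp add: sigma_bivector_def inv_sharp assms sharp_def vector_matrix_mul_assoc vector_matrix_mult_add_rdistrib)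

lemma transpose_sigma_bivector:
  assumes "transpose (\<pi>\<^sub>1 p) = - \<pi>\<^sub>1 p" "transpose (\<pi>\<^sub>2 p) = - \<pi>\<^sub>2 p" "invertible (\<pi>\<^sub>2 p)"
  shows "transpose (sigma_bivector \<pi>\<^sub>1 \<pi>\<^sub>2 p) = - sigma_bivector \<pi>\<^sub>1 \<pi>\<^sub>2 p"
proof -
  have add: "transpose (P + Q) = transpose P + transpose Q" for P Q :: "real^'a^'a"
    by (simp add: vec_eq_iff transpose_def)
  have neg: "- P ** Q = - (P ** Q)" "P ** - Q = - (P ** Q)" for P Q :: "real^'a^'a"
    by (simp_all add: vec_eq_iff matrix_matrix_mult_def sum_negf)
  show ?thesis
    by (simp add: sigma_bivector_def add matrix_transpose_mul assms transpose_matrix_inv_skew neg matrix_mul_assoc)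
qed

text \<open>Ensures that \<sigma> has the same expression in every chart, so that its smoothness and
  its Schouten bracket can be treated with the representatives of \<open>\<pi>\<^sub>1\<close> and
  \<open>\<pi>\<^sub>2\<close>.\<close>

lemma bivector_rep_sigma_bivector:
  fixes \<pi>\<^sub>1 \<pi>\<^sub>2 :: "'m::{t2_space,second_countable_topology} \<Rightarrow> real^'n^'n::finite"
  assumes atlas: "smooth_atlas A" and c: "c \<in> A" "p \<in> fst c" and inv: "invertible (\<pi>\<^sub>2 p)"
  shows "bivector_rep A c (sigma_bivector \<pi>\<^sub>1 \<pi>\<^sub>2) (snd c p) =
    sigma_bivector (bivector_rep A c \<pi>\<^sub>1) (bivector_rep A c \<pi>\<^sub>2) (snd c p)"
proof -
  let ?J = "jac (chart_at A p) c p :: real^'n^'n" and ?K = "jac c (chart_at A p) p :: real^'n^'n"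
  let ?T = "matrix_inv (\<pi>\<^sub>2 p)"
  have JK: "?J ** ?K = mat 1" "?K ** ?J = mat 1"
    using assms by (simp_all add: jac_inverse chart_at_in_atlas in_chart_at)
  have JKt: "transpose ?J ** transpose ?K = mat 1" "transpose ?K ** transpose ?J = mat 1"
    using JK by (simp_all flip: matrix_transpose_mul)
  have cancel: "M ** ?J ** ?K = M" "M ** ?K ** ?J = M" "M ** transpose ?J ** transpose ?K = M"
    "M ** transpose ?K ** transpose ?J = M" "M ** \<pi>\<^sub>2 p ** ?T = M" for M :: "real^'n^'n"
    by (simp_all add: JK JKt matrix_inv_mult inv flip: matrix_mul_assoc)
  \<comment> \<open>The inverse of a bivector transforms as a two-form, with the opposite Jacobian
    \<open>?K\<close>.\<close>
  have "matrix_inv (?J ** \<pi>\<^sub>2 p ** transpose ?J) = transpose ?K ** ?T ** ?K"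
    by (rule matrix_inv_unique) (simp add: matrix_mul_assoc cancel JK)
  moreover have "(M + N) ** R = M ** R + N ** R" for M N R :: "real^'n^'n"
    by (simp add: vec_eq_iff matrix_matrix_mult_def distrib_right sum.distrib)
  ultimately show ?thesis
    unfolding sigma_bivector_def bivector_rep_chart[OF atlas c]
    by (simp add: matrix_mul_assoc cancel matrix_add_ldistrib)
qed

lemma poisson_sigma_bivector:
  fixes \<pi>\<^sub>1 \<pi>\<^sub>2 :: "'m::{t2_space,second_countable_topology} \<Rightarrow> real^'n^'n::finite"
  assumes atlas: "smooth_atlas A" and \<pi>: "bivector_field A \<pi>\<^sub>1" "bivector_field A \<pi>\<^sub>2"
    and poisson: "poisson A (complex_bivector \<pi>\<^sub>1 \<pi>\<^sub>2)"
    and inv: "\<And>p. invertible (\<pi>\<^sub>2 p)"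
  shows "poisson A (sigma_bivector \<pi>\<^sub>1 \<pi>\<^sub>2)"
proof -
  let ?\<sigma> = "sigma_bivector \<pi>\<^sub>1 \<pi>\<^sub>2"
  have skew: "transpose (\<pi>\<^sub>1 p) = - \<pi>\<^sub>1 p" "transpose (\<pi>\<^sub>2 p) = - \<pi>\<^sub>2 p" for p
    using \<pi> by (simp_all add: bivector_field_def)
  have U: "open (snd c ` fst c)" if "c \<in> A" for c
    using open_chart_image[OF atlas that open_UNIV] by simp
  have smooth: "smooth_on (snd c ` fst c) (bivector_rep A c \<pi>\<^sub>1)"
    "smooth_on (snd c ` fst c) (bivector_rep A c \<pi>\<^sub>2)" if "c \<in> A" for c
    using \<pi> that by (simp_all add: bivector_field_def)
  have inv': "invertible (bivector_rep A c \<pi>\<^sub>2 x)" if "c \<in> A" "x \<in> snd c ` fst c" for c x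
    using that by (elim imageE) (simp add: invertible_bivector_rep[OF atlas] inv)
  have rep: "bivector_rep A c ?\<sigma> x = sigma_bivector (bivector_rep A c \<pi>\<^sub>1) (bivector_rep A c \<pi>\<^sub>2) x"
    if "c \<in> A" "x \<in> snd c ` fst c" for c x
    using that by (elim imageE) (simp add: bivector_rep_sigma_bivector[OF atlas] inv)
  have "smooth_on (snd c ` fst c) (bivector_rep A c ?\<sigma>)" if c: "c \<in> A" for c
  proof (rule smooth_on_cong[OF U[OF c] _ rep[OF c, symmetric]])
    show "smooth_on (snd c ` fst c) (sigma_bivector (bivector_rep A c \<pi>\<^sub>1) (bivector_rep A c \<pi>\<^sub>2))"
      unfolding sigma_bivector_def
      by (intro smooth_on_add smooth_on_matrix_mult smooth_on_matrix_inv U smooth inv' c)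
  qed
  then have "bivector_field A ?\<sigma>"
    by (simp add: bivector_field_def transpose_sigma_bivector skew inv)
  moreover have "schouten A ?\<sigma> ?\<sigma> p = 0" for p
    unfolding schouten_def Let_def
  proof (rule schouten_local_sigma)
    let ?c = "chart_at A p"
    note c = chart_at_in_atlas[OF atlas, of p]
    show "open (snd ?c ` fst ?c)" "snd ?c p \<in> snd ?c ` fst ?c"
      using U[OF c] in_chart_at[OF atlas] by auto
    show "schouten_local (complex_bivector (bivector_rep A ?c \<pi>\<^sub>1) (bivector_rep A ?c \<pi>\<^sub>2))
        (complex_bivector (bivector_rep A ?c \<pi>\<^sub>1) (bivector_rep A ?c \<pi>\<^sub>2)) (snd ?c p) = 0"
      using poisson by (simp add: poisson_def schouten_def Let_def bivector_rep_complex_bivector)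
    fix y assume y: "y \<in> snd ?c ` fst ?c"
    show "bivector_rep A ?c ?\<sigma> y = bivector_rep A ?c \<pi>\<^sub>1 y ** matrix_inv (bivector_rep A ?c \<pi>\<^sub>2 y) **
        bivector_rep A ?c \<pi>\<^sub>1 y + bivector_rep A ?c \<pi>\<^sub>2 y"
      using rep[OF c y] by (simp add: sigma_bivector_def)
  qed (auto intro!: smooth inv' chart_at_in_atlas transpose_bivector_rep transpose_sigma_bivector skew inv atlas)
  ultimately show ?thesis
    by (simp add: poisson_def)
qed

section \<open>The criterion, the formula for the map and its Poisson bivector\<close>

theorem theorem8p10:
  fixes A :: "('m::{t2_space,second_countable_topology}, 'n::finite) chart set"
    and \<pi>\<^sub>1 \<pi>\<^sub>2 :: "'m \<Rightarrow> real^'n^'n"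
  assumes "smooth_atlas A"
    and "bivector_field A \<pi>\<^sub>1" and "bivector_field A \<pi>\<^sub>2"
    and "poisson A (complex_bivector \<pi>\<^sub>1 \<pi>\<^sub>2)"
  shows "(generalized_complex A (bivector_graph (complex_bivector \<pi>\<^sub>1 \<pi>\<^sub>2)) \<longleftrightarrow>
            (\<forall>p. bij (sharp (\<pi>\<^sub>2 p)))) \<and>
         ((\<forall>p. bij (sharp (\<pi>\<^sub>2 p))) \<longrightarrow>
            (\<forall>J. generalized_complex_map A (bivector_graph (complex_bivector \<pi>\<^sub>1 \<pi>\<^sub>2)) J \<longleftrightarrow>
               (\<forall>p X \<xi>. J p (X, \<xi>) =
                  (- sharp (\<pi>\<^sub>1 p) (inv (sharp (\<pi>\<^sub>2 p)) X)
                     + (sharp (\<pi>\<^sub>1 p) (inv (sharp (\<pi>\<^sub>2 p)) (sharp (\<pi>\<^sub>1 p) \<xi>)) + sharp (\<pi>\<^sub>2 p) \<xi>),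
                   - inv (sharp (\<pi>\<^sub>2 p)) X + inv (sharp (\<pi>\<^sub>2 p)) (sharp (\<pi>\<^sub>1 p) \<xi>)))) \<and>
            (\<exists>\<sigma>. (\<forall>p \<xi>. sharp (\<sigma> p) \<xi> =
                    sharp (\<pi>\<^sub>1 p) (inv (sharp (\<pi>\<^sub>2 p)) (sharp (\<pi>\<^sub>1 p) \<xi>)) + sharp (\<pi>\<^sub>2 p) \<xi>) \<and>
                 (\<forall>J. generalized_complex_map A (bivector_graph (complex_bivector \<pi>\<^sub>1 \<pi>\<^sub>2)) J \<longrightarrow>
                    associated_poisson A J \<sigma>)))"
proof (intro conjI impI)
  \<comment> \<open>The graph of a complex Poisson bivector is always a complex Dirac structure, so
    the equivalence is decided by the intersection with the conjugate alone.\<close>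
  have "bivector_field A (complex_bivector \<pi>\<^sub>1 \<pi>\<^sub>2)"
    using assms(4) by (simp add: poisson_def)
  then have "complex_dirac A (bivector_graph (complex_bivector \<pi>\<^sub>1 \<pi>\<^sub>2))"
    using assms smooth_subbundle_bivector_graph involutive_bivector_graph
    by (auto simp: complex_dirac_def bivector_field_def intro!: lagrangian_bivector_graph)
  then show "generalized_complex A (bivector_graph (complex_bivector \<pi>\<^sub>1 \<pi>\<^sub>2)) \<longleftrightarrow> (\<forall>p. bij (sharp (\<pi>\<^sub>2 p)))"
    by (simp add: generalized_complex_def bivector_graph_inter_gcnj)
next
  assume "\<forall>p. bij (sharp (\<pi>\<^sub>2 p))"
  then have bij: "bij (sharp (\<pi>\<^sub>2 p))" and inv: "invertible (\<pi>\<^sub>2 p)" for p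
    by (simp_all add: invertible_iff_bij_sharp)
  note gc = generalized_complex_map_iff_gc_map[OF assms(1-3) bij]
  show "\<forall>J. generalized_complex_map A (bivector_graph (complex_bivector \<pi>\<^sub>1 \<pi>\<^sub>2)) J \<longleftrightarrow>
      (\<forall>p X \<xi>. J p (X, \<xi>) =
        (- sharp (\<pi>\<^sub>1 p) (inv (sharp (\<pi>\<^sub>2 p)) X)
           + (sharp (\<pi>\<^sub>1 p) (inv (sharp (\<pi>\<^sub>2 p)) (sharp (\<pi>\<^sub>1 p) \<xi>)) + sharp (\<pi>\<^sub>2 p) \<xi>),
         - inv (sharp (\<pi>\<^sub>2 p)) X + inv (sharp (\<pi>\<^sub>2 p)) (sharp (\<pi>\<^sub>1 p) \<xi>)))"
    by (simp add: gc fun_eq_iff gc_map_def)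
  \<comment> \<open>Evaluating the map at (0, \<xi>) kills the blocks acting on vectors, and the
    upper right block remains.\<close>
  have "inv (sharp (\<pi>\<^sub>2 p)) 0 = 0" "sharp (\<pi>\<^sub>1 p) 0 = 0" for p
    by (simp_all add: inv_sharp inv sharp_def)
  then have "associated_poisson A (gc_map \<pi>\<^sub>1 \<pi>\<^sub>2) (sigma_bivector \<pi>\<^sub>1 \<pi>\<^sub>2)"
    using poisson_sigma_bivector[OF assms inv]
    by (simp add: associated_poisson_def sharp_sigma_bivector inv gc_map_def)
  then show "\<exists>\<sigma>. (\<forall>p \<xi>. sharp (\<sigma> p) \<xi> =
        sharp (\<pi>\<^sub>1 p) (inv (sharp (\<pi>\<^sub>2 p)) (sharp (\<pi>\<^sub>1 p) \<xi>)) + sharp (\<pi>\<^sub>2 p) \<xi>) \<and>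
      (\<forall>J. generalized_complex_map A (bivector_graph (complex_bivector \<pi>\<^sub>1 \<pi>\<^sub>2)) J \<longrightarrow>
         associated_poisson A J \<sigma>)"
    by (intro exI[of _ "sigma_bivector \<pi>\<^sub>1 \<pi>\<^sub>2"]) (simp add: gc sharp_sigma_bivector inv)
qed

end
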